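(* Let $N\ge 1$ be an integer, $c>0$, $\alpha>0$ with $\alpha\neq 1$, and for $k=1,\dots,N$ let $a_k>0$, $\gamma_k\in[0,1]$, $b_k\in(0,1)$ with $2-\alpha-\gamma_k\neq 0$. Let $J_k,G_k$, the policy classes ${\cal U}'$, ${\cal U}$, the thresholds $\bar x_k(\lambda)$, the set $\Omega\subset\mathbb{R}^{2N}$ and the functions $\tilde J,\tilde G$ on $\Omega$ be as defined in the context. Then: (a) The set $\Omega$ is convex in $\mathbb{R}^{2N}$, and the functions $\omega\mapsto-\tilde J(\omega)$ and $\omega\mapsto\tilde G(\omega)$ on $\Omega$ are convex and real-valued. (b) There exists $\hat\omega\in\Omega$ such that $\tilde G(\hat\omega)<c$ (i.e. Slater's condition holds for the problem of minimizing $-\tilde J(\omega)$ over $\omega\in\Omega$ subject to $\tilde G(\omega)-c\le 0$). (c) For every initial state, the threshold policy $u^*=(u_1^*,\dots,u_N^* )\in{\cal U}'$, where $u_k^*$ is induced by the threshold $\bar x_k(\lambda^* )$, is optimal for the problem $$J(u)=\sum_{k=1}^N J_k(u_k)\longrightarrow\sup_{u\in{\cal U}},\qquad\text{subject to } \sum_{k=1}^N G_k(u_k)\le c,$$ where $$\lambda^*=\frac1{c^\alpha}\Biggl(\sum_{k:\gamma_k\ne1}\frac{1-\gamma_k}{2-\gamma_k}\,\frac{1-b_k^{2-\gamma_k}}{1-b_k^{1-\gamma_k}}\left(\frac{2-\gamma_k}{1-b_k^{2-\gamma_k}}\right)^{1/\alpha}\left(\frac{1-b_k^{2-\alpha-\gamma_k}}{2-\alpha-\gamma_k}\right)^{1/\alpha}+\sum_{k:\gamma_k=1}\left(\frac{1-b_k^{1-\alpha}}{1-\alpha}\right)^{1/\alpha}\frac{(1-b_k)^{(\alpha-1)/\alpha}}{-\ln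 b_k}\Biggr)^{\alpha}.$$ In the homogeneous case ($\gamma_k=\gamma$ and $b_k=b$ for all $k$): if $\gamma\neq1$, then $$\lambda^*=\frac{N^\alpha}{c^\alpha}\,\frac{(1-\gamma)^\alpha}{(1-b^{1-\gamma})^\alpha}\,\frac{(1-b^{2-\gamma})^\alpha}{(2-\gamma)^\alpha}\,\frac{2-\gamma}{1-b^{2-\gamma}}\,\frac{1-b^{2-\alpha-\gamma}}{2-\alpha-\gamma}\quad\text{and}\quad \bar x_k(\lambda^* )=\frac cN\,\frac{1-b^{1-\gamma}}{1-\gamma}\,\frac{2-\gamma}{1-b^{2-\gamma}};$$ and if $\gamma=1$, then $$\lambda^*=\frac1{c^\alpha}\left(N\,\frac{(1-b^{1-\alpha})^{1/\alpha}(b-1)}{((1-b)(1-\alpha))^{1/\alpha}\ln b}\right)^\alpha.$$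
   Context: Dynamics. There are $N$ users; the allocation to user $k$ is $x_k(t)>0$, $t\ge0$, with an arbitrary fixed initial value $x_k(0)>0$. Between impulses $\frac{dx_k}{dt}=a_kx_k^{\gamma_k}$. When an impulse is applied to user $k$ at time $t$, $x_k(t+0)=b_kx_k(t)$ (several impulses at the same time multiply the rate by the corresponding power of $b_k$). Policies. A (deterministic) policy for user $k$ is a nondecreasing sequence $T=\{T_1,T_2,\dots\}$ of constants in $[0,\infty]$ (the impulse times; repeated times are allowed) with $\lim_{n\to\infty}T_n=\infty$; the set of these is ${\cal U}'_k$. For policies $T,S$ and $\beta\in[0,1]$, the mixture $(\beta,T,S)$ chooses the sequence $T$ with probability $\beta$ and $S$ with probability $1-\beta$; the set of all mixtures is ${\cal U}_k\supseteq{\cal U}'_k$. Put ${\cal U}'=\prod_{k=1}^N{\cal U}'_k$, ${\cal U}=\prod_{k=1}^N{\cal U}_k$. $E^{u_k}$ is the expectation under $u_k\in{\cal U}_k$. Objectives. For $u_k\in{\cal U}_k$, $$J_k(u_k)=\liminf_{\tau\to\infty}\frac1\tau E^{u_k}\left[\int_0^\tau\frac{x_k^{1-\alpha}(t)}{1-\alpha}dt\right],\qquad G_k(u_k)=\limsup_{\tau\to\infty}\frac1\tau E^{u_k}\left[\int_0^\tau x_k(t)dt\right].$$ Thresholds. For $\lambda>0$, $$\bar x_k(\lambda)=\left\{\frac{(2-\gamma_k)(1-b_k^{2-\alpha-\gamma_k})}{(1-b_k^{2-\gamma_k})(2-\alpha-\gamma_k)\lambda}\right\}^{1/\alpha}.$$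 The threshold policy for user $k$ with threshold $\bar x$ is the deterministic policy that applies an impulse at time $t$ as soon as $x_k(t)\ge\bar x$ (with repeated impulses at the same time if needed). Let $J_k^*(\lambda)$ and $G_k^*(\lambda)$ be the values of $J_k$ and $G_k$ under the threshold policy with threshold $\bar x_k(\lambda)$. Performance space. $\Omega_k\subset\mathbb{R}^2$ is the convex hull of the curve $\{(-J_k^*(\lambda),G_k^*(\lambda)):\lambda>0\}$, and $\Omega=\prod_{k=1}^N\Omega_k\subset\mathbb{R}^{2N}$. For $\omega=\{(\omega_k^1,\omega_k^2)\}_{k=1}^N\in\Omega$ put $-\tilde J(\omega)=\sum_{k=1}^N\omega_k^1$ and $\tilde G(\omega)=\sum_{k=1}^N\omega_k^2$. *)

theory Defs
  imports "HOL-Probability.Probability"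
begin

section \<open>Impulse policies and controlled trajectories\<close>

text \<open>The type ennreal is the interval $[0,\infty]$; the value \<open>\<infinity>\<close> stands for an impulse that is
  never applied. The policy set is the same for all users.\<close>

definition policies :: "(nat \<Rightarrow> ennreal) set" where
  "policies = {T. incseq T \<and> T \<longlonglongrightarrow> \<infinity>}"

definition impulses_at :: "(nat \<Rightarrow> ennreal) \<Rightarrow> real \<Rightarrow> nat" where
  "impulses_at T t = card {n. T n = ennreal t}"

text \<open>Trajectories are left-continuous: at an impulse time, \<open>x t\<close> is the value before the impulses
  and the right limit is the value after all of them.\<close>

definition is_trajectory ::
  "real \<Rightarrow> real \<Rightarrow> real \<Rightarrow> real \<Rightarrow> (nat \<Rightarrow> ennreal) \<Rightarrow> (real \<Rightarrow> real) \<Rightarrow> bool" where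
  "is_trajectory a \<gamma> b x0 T x \<longleftrightarrow>
     x 0 = x0 \<and>
     (\<forall>t\<ge>0. x t > 0) \<and>
     (\<forall>t>0. (x \<longlongrightarrow> x t) (at_left t)) \<and>
     (\<forall>t\<ge>0. (x \<longlongrightarrow> b ^ impulses_at T t * x t) (at_right t)) \<and>
     (\<forall>t>0. impulses_at T t = 0 \<longrightarrow>
        (x has_real_derivative a * x t powr \<gamma>) (at t))"

text \<open>For \<open>a > 0\<close>, \<open>0 \<le> \<gamma> \<le> 1\<close>, \<open>0 < b < 1\<close>, \<open>x0 > 0\<close> and \<open>T \<in> policies\<close> a trajectory exists and is
  unique on $[0,\infty)$. Its values at negative times are irrelevant below.\<close>

definition trajectory ::
  "real \<Rightarrow> real \<Rightarrow> real \<Rightarrow> real \<Rightarrow> (nat \<Rightarrow> ennreal) \<Rightarrow> real \<Rightarrow> real" where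
  "trajectory a \<gamma> b x0 T = (SOME x. is_trajectory a \<gamma> b x0 T x)"

text \<open>A mixture is the probability distribution of the randomly chosen sequence of impulse times.
  A deterministic policy \<open>T\<close> is identified with \<open>return_pmf T\<close>, which is \<open>mixture 1 T T\<close>.\<close>

definition mixture ::
  "real \<Rightarrow> (nat \<Rightarrow> ennreal) \<Rightarrow> (nat \<Rightarrow> ennreal) \<Rightarrow> (nat \<Rightarrow> ennreal) pmf" where
  "mixture \<beta> T S = map_pmf (\<lambda>c. if c then T else S) (bernoulli_pmf \<beta>)"

definition mixed_policies :: "(nat \<Rightarrow> ennreal) pmf set" where
  "mixed_policies = {mixture \<beta> T S | \<beta> T S. \<beta> \<in> {0..1} \<and> T \<in> policies \<and> S \<in> policies}"

section \<open>Objectives\<close>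

definition J_obj ::
  "real \<Rightarrow> real \<Rightarrow> real \<Rightarrow> real \<Rightarrow> real \<Rightarrow> (nat \<Rightarrow> ennreal) pmf \<Rightarrow> ereal" where
  "J_obj \<alpha> a \<gamma> b x0 u = Liminf at_top (\<lambda>\<tau>. ereal (1 / \<tau> *
     measure_pmf.expectation u (\<lambda>T.
       integral {0..\<tau>} (\<lambda>t. trajectory a \<gamma> b x0 T t powr (1 - \<alpha>) / (1 - \<alpha>)))))"

definition G_obj ::
  "real \<Rightarrow> real \<Rightarrow> real \<Rightarrow> real \<Rightarrow> (nat \<Rightarrow> ennreal) pmf \<Rightarrow> ereal" where
  "G_obj a \<gamma> b x0 u = Limsup at_top (\<lambda>\<tau>. ereal (1 / \<tau> *
     measure_pmf.expectation u (\<lambda>T. integral {0..\<tau>} (\<lambda>t. trajectory a \<gamma> b x0 T t))))"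

definition optimal_for ::
  "('p \<Rightarrow> ereal) \<Rightarrow> ('p \<Rightarrow> ereal) \<Rightarrow> real \<Rightarrow> 'p set \<Rightarrow> 'p \<Rightarrow> bool" where
  "optimal_for J G c U u \<longleftrightarrow>
     u \<in> U \<and> G u \<le> ereal c \<and> (\<forall>v\<in>U. G v \<le> ereal c \<longrightarrow> J v \<le> J u)"

section \<open>Threshold policies\<close>

definition threshold :: "real \<Rightarrow> real \<Rightarrow> real \<Rightarrow> real \<Rightarrow> real" where
  "threshold \<alpha> \<gamma> b lam =
     ((2 - \<gamma>) * (1 - b powr (2 - \<alpha> - \<gamma>)) /
      ((1 - b powr (2 - \<gamma>)) * (2 - \<alpha> - \<gamma>) * lam)) powr (1 / \<alpha>)"

text \<open>At every time, impulses are applied as long as the current value is at least \<open>xbar\<close>. So their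
  number is the least \<open>m\<close> for which \<open>m\<close> impulses bring the value below \<open>xbar\<close>; in particular it is
  0 if \<open>x t < xbar\<close>.\<close>

definition is_threshold_policy ::
  "real \<Rightarrow> real \<Rightarrow> real \<Rightarrow> real \<Rightarrow> real \<Rightarrow> (nat \<Rightarrow> ennreal) \<Rightarrow> bool" where
  "is_threshold_policy a \<gamma> b x0 xbar T \<longleftrightarrow>
     T \<in> policies \<and>
     (\<forall>t\<ge>0. impulses_at T t = (LEAST m. b ^ m * trajectory a \<gamma> b x0 T t < xbar))"

definition threshold_policy ::
  "real \<Rightarrow> real \<Rightarrow> real \<Rightarrow> real \<Rightarrow> real \<Rightarrow> nat \<Rightarrow> ennreal" where
  "threshold_policy a \<gamma> b x0 xbar = (THE T. is_threshold_policy a \<gamma> b x0 xbar T)"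

definition J_star :: "real \<Rightarrow> real \<Rightarrow> real \<Rightarrow> real \<Rightarrow> real \<Rightarrow> real \<Rightarrow> ereal" where
  "J_star \<alpha> a \<gamma> b x0 lam =
     J_obj \<alpha> a \<gamma> b x0 (return_pmf (threshold_policy a \<gamma> b x0 (threshold \<alpha> \<gamma> b lam)))"

definition G_star :: "real \<Rightarrow> real \<Rightarrow> real \<Rightarrow> real \<Rightarrow> real \<Rightarrow> real \<Rightarrow> ereal" where
  "G_star \<alpha> a \<gamma> b x0 lam =
     G_obj a \<gamma> b x0 (return_pmf (threshold_policy a \<gamma> b x0 (threshold \<alpha> \<gamma> b lam)))"

section \<open>Performance space\<close>

definition user_space :: "real \<Rightarrow> real \<Rightarrow> real \<Rightarrow> real \<Rightarrow> real \<Rightarrow> (real \<times> real) set" where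
  "user_space \<alpha> a \<gamma> b x0 =
     convex hull {(- real_of_ereal (J_star \<alpha> a \<gamma> b x0 lam), real_of_ereal (G_star \<alpha> a \<gamma> b x0 lam)) | lam. lam > 0}"

text \<open>The users form a finite index type, and $\mathbb{R}^{2N}$ is the product of the \<open>N\<close> planes in
  which the single performance spaces lie.\<close>

definition performance_space ::
  "real \<Rightarrow> ('n \<Rightarrow> real) \<Rightarrow> ('n \<Rightarrow> real) \<Rightarrow> ('n \<Rightarrow> real) \<Rightarrow> ('n \<Rightarrow> real) \<Rightarrow> ((real \<times> real) ^ 'n::finite) set" where
  "performance_space \<alpha> a \<gamma> b x0 = {\<omega>. \<forall>k. \<omega> $ k \<in> user_space \<alpha> (a k) (\<gamma> k) (b k) (x0 k)}"

definition J_tilde :: "(real \<times> real) ^ 'n::finite \<Rightarrow> real" where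
  "J_tilde \<omega> = - (\<Sum>k\<in>UNIV. fst (\<omega> $ k))"

definition G_tilde :: "(real \<times> real) ^ 'n::finite \<Rightarrow> real" where
  "G_tilde \<omega> = (\<Sum>k\<in>UNIV. snd (\<omega> $ k))"

definition lambda_star ::
  "real \<Rightarrow> real \<Rightarrow> ('n::finite \<Rightarrow> real) \<Rightarrow> ('n \<Rightarrow> real) \<Rightarrow> real" where
  "lambda_star c \<alpha> \<gamma> b = 1 / c powr \<alpha> *
     ((\<Sum>k\<in>{k. \<gamma> k \<noteq> 1}.
         (1 - \<gamma> k) / (2 - \<gamma> k) *
         ((1 - b k powr (2 - \<gamma> k)) / (1 - b k powr (1 - \<gamma> k))) *
         ((2 - \<gamma> k) / (1 - b k powr (2 - \<gamma> k))) powr (1 / \<alpha>) *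
         ((1 - b k powr (2 - \<alpha> - \<gamma> k)) / (2 - \<alpha> - \<gamma> k)) powr (1 / \<alpha>)) +
      (\<Sum>k\<in>{k. \<gamma> k = 1}.
         ((1 - b k powr (1 - \<alpha>)) / (1 - \<alpha>)) powr (1 / \<alpha>) *
         ((1 - b k) powr ((\<alpha> - 1) / \<alpha>) / (- ln (b k))))) powr \<alpha>"

end

theory Submission
  imports Defs
begin

text \<open>If \<open>H' x = x powr (q - \<gamma>)\<close>, then along a trajectory \<open>H\<close> grows at rate \<open>a * x powr q\<close>, so \<open>a\<close> times
  the integral of \<open>x powr q\<close> equals, up to boundary terms, the sum over the impulses of the losses
  \<open>H x - H (b * x) = x powr (q + 1 - \<gamma>) * gap b (q + 1 - \<gamma>)\<close>. For \<open>q = 0\<close> this measures time. Maximizing the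
  Lagrangian average thus amounts to maximizing, over the rate \<open>x\<close> before an impulse, the concave
  function \<open>c1 * x powr (1 - \<alpha>) / (1 - \<alpha>) - lam * c2 * x\<close> with \<open>c1 = gap b (2 - \<alpha> - \<gamma>) / gap b (1 - \<gamma>)\<close> and
  \<open>c2 = gap b (2 - \<gamma>) / gap b (1 - \<gamma>)\<close>, and the threshold is its maximizer. The boundary terms may be
  unbounded when the rate becomes small; a bounded-below modification of the value function takes
  care of this and makes the estimate uniform in the policy and the horizon, hence valid for mixtures. The multiplier
  \<open>\<lambda>*\<close> is the one for which the threshold policies use up the budget \<open>c\<close>.\<close>

section \<open>Impulse times\<close>

text \<open>Two obstacles shape the proof. A threshold policy is specified through the trajectory
  that it itself induces. This circle is broken by guessing its impulse times explicitly and by a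
  uniqueness theorem for trajectories whose impulses are in feedback form, which gives the definite
  description in \<open>threshold_policy\<close> its meaning. The second obstacle is the exact
  relative value function \<open>h0\<close>, with derivative
  \<open>(\<rho> - f x) * x powr (- \<gamma>) / a\<close>. It tends to minus infinity at 0 as soon
  as \<open>\<gamma> = 1\<close> or \<open>\<alpha> + \<gamma> \<ge> 2\<close>, while an arbitrary
  policy may drive the rate towards 0, so \<open>h0 (x \<tau>) / \<tau>\<close> cannot be neglected.
  The repair works because near 0 the running reward \<open>f\<close> is increasing and at most
  \<open>\<rho>\<close>. Hence the derivative is nonnegative and nonincreasing there, and freezing
  it below a small level turns the optimality equation into an inequality of the right
  direction.\<close>

definition impulse_times :: "(nat \<Rightarrow> ennreal) \<Rightarrow> real set" where
  "impulse_times T = {t. 0 \<le> t \<and> impulses_at T t \<noteq> 0}"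

lemma finite_indices_le:
  assumes "T \<in> policies"
  shows "finite {n. T n \<le> ennreal r}"
proof -
  have "T \<longlonglongrightarrow> \<infinity>"
    using assms by (simp add: policies_def)
  then have "\<forall>\<^sub>F n in sequentially. ennreal r < T n"
    by (rule order_tendstoD) simp
  then obtain M where "\<And>n. n \<ge> M \<Longrightarrow> ennreal r < T n"
    by (auto simp: eventually_sequentially)
  then have "{n. T n \<le> ennreal r} \<subseteq> {..<M}"
    by (metis leD lessThan_iff linorder_not_less mem_Collect_eq subsetI)
  then show ?thesis
    by (rule finite_subset) simp
qed

lemma finite_indices_eq:
  assumes "T \<in> policies"
  shows "finite {n. T n = ennreal r}"
  by (rule finite_subset[OF _ finite_indices_le[OF assms, of r]]) auto

text \<open>An infinite set has \<open>card\<close> 0, so \<open>impulses_at\<close> registers an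
  impulse only because finitely many indices share its time.\<close>

lemma impulse_timesI:
  assumes "T \<in> policies" "0 \<le> t" "T n = ennreal t"
  shows "t \<in> impulse_times T"
proof -
  have "card {n. T n = ennreal t} \<noteq> 0"
    using finite_indices_eq[OF assms(1), of t] assms(3) by (simp only: card_eq_0_iff) blast
  with assms(2) show ?thesis
    by (simp add: impulse_times_def impulses_at_def)
qed

lemma finite_impulse_times_le:
  assumes "T \<in> policies"
  shows "finite (impulse_times T \<inter> {..r})"
proof (rule finite_subset)
  show "impulse_times T \<inter> {..r} \<subseteq> (\<lambda>n. enn2real (T n)) ` {n. T n \<le> ennreal r}"
  proof
    fix t assume t: "t \<in> impulse_times T \<inter> {..r}"
    then have "card {n. T n = ennreal t} \<noteq> 0"
      by (simp add: impulse_times_def impulses_at_def)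
    then have "{n. T n = ennreal t} \<noteq> {}"
      by (metis card.empty)
    then obtain n where "T n = ennreal t"
      by auto
    with t show "t \<in> (\<lambda>n. enn2real (T n)) ` {n. T n \<le> ennreal r}"
      by (intro image_eqI[of _ _ n]) (auto simp: impulse_times_def ennreal_leI)
  qed
qed (simp add: finite_indices_le[OF assms])

lemma finite_impulse_times_less:
  assumes "T \<in> policies"
  shows "finite (impulse_times T \<inter> {..<r})"
  by (rule finite_subset[OF _ finite_impulse_times_le[OF assms, of r]]) auto

lemma impulse_free_neighbourhood:
  assumes "T \<in> policies"
  obtains e where "e > 0" "\<And>s. s \<in> impulse_times T \<Longrightarrow> s \<noteq> t \<Longrightarrow> e \<le> \<bar>s - t\<bar>"
proof -
  obtain d where d: "d > 0" "\<And>s. s \<in> impulse_times T \<inter> {..t + 1} \<Longrightarrow> s \<noteq> t \<Longrightarrow> d \<le> dist t s"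
    using finite_set_avoid[OF finite_impulse_times_le[OF assms, of "t + 1"], of t] by blast
  show ?thesis
  \<comment> \<open>The bound 1 takes care of the impulses after \<open>t + 1\<close>, which the
    finite set behind \<open>d\<close> leaves out.\<close>
  proof (rule that[of "min d 1"])
    fix s assume s: "s \<in> impulse_times T" "s \<noteq> t"
    show "min d 1 \<le> \<bar>s - t\<bar>"
    proof (cases "s \<le> t + 1")
      case True
      with s d(2)[of s] show ?thesis by (auto simp: dist_real_def abs_minus_commute)
    next
      case False
      then show ?thesis by auto
    qed
  qed (use d in auto)
qed

text \<open>At the first index where two nondecreasing sequences differ, the smaller entry is
  finite, and the sequence containing it takes that value more often than the other one does. Hence
  the multiplicities at finite times determine a policy.\<close>

lemma policy_eqI:
  assumes "T \<in> policies" "S \<in> policies"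
    and eq: "\<And>t. 0 \<le> t \<Longrightarrow> impulses_at T t = impulses_at S t"
  shows "T = S"
proof (rule ccontr)
  have *: False
    if pol: "T \<in> policies" "S \<in> policies" and eq: "\<And>t. 0 \<le> t \<Longrightarrow> impulses_at T t = impulses_at S t"
      and below: "\<And>k. k < n \<Longrightarrow> T k = S k" and less: "T n < S n" for T S n
  proof -
    obtain r where r: "0 \<le> r" "T n = ennreal r"
      using less by (cases "T n") auto
    have "{k. S k = ennreal r} \<subseteq> {k. T k = ennreal r} - {n}"
    proof
      fix k assume k: "k \<in> {k. S k = ennreal r}"
      have "k < n"
      proof (rule ccontr)
        assume "\<not> k < n"
        then have "S n \<le> S k"
          using pol(2) by (auto simp: policies_def incseq_def)
        with k less r show False by auto
      qed
      with k below show "k \<in> {k. T k = ennreal r} - {n}" by auto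
    qed
    also have "\<dots> \<subset> {k. T k = ennreal r}"
      using r by auto
    finally have "impulses_at S r < impulses_at T r"
      unfolding impulses_at_def using finite_indices_eq[OF pol(1)] by (rule psubset_card_mono[rotated])
    with eq[OF r(1)] show False by simp
  qed
  assume "T \<noteq> S"
  then have ex: "\<exists>n. T n \<noteq> S n" by auto
  define n where "n = (LEAST n. T n \<noteq> S n)"
  have n: "T n \<noteq> S n"
    unfolding n_def using ex by (rule LeastI_ex)
  have below: "T k = S k" if "k < n" for k
    using not_less_Least[OF that[unfolded n_def]] by auto
  from n consider "T n < S n" | "S n < T n"
    by (rule linorder_neqE)
  then show False
    using *[of T S n] *[of S T n] assms below by (metis)
qed

section \<open>Powers and their primitives\<close>

text \<open>The case \<open>q = 0\<close> is the limiting one; with it \<open>\<gamma> = 1\<close> needs no separate treatment.\<close>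

definition antipow :: "real \<Rightarrow> real \<Rightarrow> real" where
  "antipow q x = (if q = 0 then ln x else x powr q / q)"

text \<open>This is the integral of \<open>z powr (q - 1)\<close> over \<open>[b, 1]\<close>, hence
  positive for every real \<open>q\<close>. By homogeneity it is the loss of
  \<open>antipow q\<close> at one impulse from level 1.\<close>

definition gap :: "real \<Rightarrow> real \<Rightarrow> real" where
  "gap b q = antipow q 1 - antipow q b"

lemma antipow_deriv:
  assumes "x > 0"
  shows "(antipow q has_real_derivative x powr (q - 1)) (at x)"
proof (cases "q = 0")
  case True
  then have "antipow q = ln" by (auto simp: antipow_def)
  with assms True show ?thesis
    by (auto intro!: derivative_eq_intros simp: powr_minus divide_simps)
next
  case False
  then have "antipow q = (\<lambda>x. x powr q / q)" by (auto simp: antipow_def)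
  with assms False show ?thesis
    by (auto intro!: derivative_eq_intros)
qed

lemma antipow_less:
  assumes "0 < x" "x < y"
  shows "antipow q x < antipow q y"
proof (rule DERIV_pos_imp_increasing[OF assms(2)])
  fix z assume "x \<le> z" "z \<le> y"
  then show "\<exists>d. (antipow q has_real_derivative d) (at z) \<and> 0 < d"
    using assms antipow_deriv[of z q] by (intro exI[of _ "z powr (q - 1)"]) auto
qed

lemma antipow_inj:
  assumes "0 < x" "0 < y" "antipow q x = antipow q y"
  shows "x = y"
  using antipow_less[of x y q] antipow_less[of y x q] assms
  by (cases x y rule: linorder_cases) auto

lemma gap_pos:
  assumes "0 < b" "b < 1"
  shows "gap b q > 0"
  using antipow_less[OF assms, of q] by (simp add: gap_def)

lemma antipow_diff:
  assumes "0 < b" "0 < x"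
  shows "antipow q x - antipow q (b * x) = x powr q * gap b q"
  using assms by (auto simp: antipow_def gap_def ln_mult powr_mult field_simps)

lemma gap_eq: "gap b q = (if q = 0 then - ln b else (1 - b powr q) / q)"
  by (simp add: gap_def antipow_def diff_divide_distrib)

section \<open>Trajectories\<close>

locale user =
  fixes a \<gamma> b :: real
  assumes a_pos: "a > 0" and gamma: "0 \<le> \<gamma>" "\<gamma> \<le> 1" and b_pos: "0 < b" and b_less: "b < 1"
begin

abbreviation traj where "traj \<equiv> is_trajectory a \<gamma> b"

lemma trajectory_pos: "traj x0 T x \<Longrightarrow> 0 \<le> t \<Longrightarrow> x t > 0"
  by (simp add: is_trajectory_def)

lemma gaps_pos: "gap b q > 0"
  using gap_pos[OF b_pos b_less] .

text \<open>Adding up the losses at the impulses turns \<open>H (x t)\<close> into a continuous function of \<open>t\<close>.\<close>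

lemma integral_along_trajectory:
  assumes T: "T \<in> policies" and x: "traj x0 T x" and tau: "0 \<le> \<tau>"
    and H: "\<And>y. y > 0 \<Longrightarrow> (H has_real_derivative H' y) (at y)"
  shows "((\<lambda>t. H' (x t) * (a * x t powr \<gamma>)) has_integral
      (H (x \<tau>) - H x0 +
        (\<Sum>s\<in>impulse_times T \<inter> {..<\<tau>}. H (x s) - H (b ^ impulses_at T s * x s)))) {0..\<tau>}"
proof -
  define L where "L s = H (x s) - H (b ^ impulses_at T s * x s)" for s
  \<comment> \<open>The inequality is strict because \<open>x t\<close> is the value before the
    impulses at \<open>t\<close>: the loss at \<open>t\<close> enters \<open>\<Phi>\<close> only to
    the right of \<open>t\<close>, where it cancels the jump of \<open>H (x t)\<close>.\<close>
  define I where "I t = impulse_times T \<inter> {..<t}" for t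
  define \<Phi> where "\<Phi> t = H (x t) + sum L (I t)" for t
  have fin: "finite (I t)" for t
    unfolding I_def by (rule finite_impulse_times_less[OF T])
  have pos: "x t > 0" if "0 \<le> t" for t
    using trajectory_pos[OF x that] .
  have left: "(\<Phi> \<longlongrightarrow> \<Phi> t) (at_left t)" if "0 < t" for t
  proof -
    obtain e where e: "e > 0" "\<And>s. s \<in> impulse_times T \<Longrightarrow> s \<noteq> t \<Longrightarrow> e \<le> \<bar>s - t\<bar>"
      using impulse_free_neighbourhood[OF T] by blast
    have "I s = I t" if "s \<in> {t - e<..<t}" for s
      using that e(2) by (force simp: I_def)
    then have ev: "\<forall>\<^sub>F s in at_left t. H (x s) + sum L (I t) = \<Phi> s"
      unfolding \<Phi>_def using e(1)
      by (intro eventually_at_leftI[of "t - e"]) auto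
    have "(x \<longlongrightarrow> x t) (at_left t)"
      using x \<open>0 < t\<close> by (simp add: is_trajectory_def)
    moreover have "isCont H (x t)"
      using H[of "x t"] pos[of t] \<open>0 < t\<close> by (auto intro: DERIV_isCont)
    ultimately have "((\<lambda>s. H (x s)) \<longlongrightarrow> H (x t)) (at_left t)"
      by (metis isCont_tendsto_compose)
    then have "((\<lambda>s. H (x s) + sum L (I t)) \<longlongrightarrow> \<Phi> t) (at_left t)"
      unfolding \<Phi>_def by (intro tendsto_intros)
    then show ?thesis
      using ev by (rule Lim_transform_eventually)
  qed
  have right: "(\<Phi> \<longlongrightarrow> \<Phi> t) (at_right t)" if "0 \<le> t" for t
  proof -
    obtain e where e: "e > 0" "\<And>s. s \<in> impulse_times T \<Longrightarrow> s \<noteq> t \<Longrightarrow> e \<le> \<bar>s - t\<bar>"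
      using impulse_free_neighbourhood[OF T] by blast
    have "sum L (I s) = sum L (I t) + L t" if s: "s \<in> {t<..<t + e}" for s
    proof (cases "t \<in> impulse_times T")
      case True
      then have "I s = insert t (I t)"
        using s e(2) by (force simp: I_def)
      then show ?thesis
        using fin[of t] by (simp add: I_def)
    next
      case False
      then have "I s = I t"
        using s e(2) by (force simp: I_def)
      moreover have "L t = 0"
        using False that \<open>0 \<le> t\<close> by (simp add: L_def impulse_times_def)
      ultimately show ?thesis by simp
    qed
    then have ev: "\<forall>\<^sub>F s in at_right t. H (x s) + (sum L (I t) + L t) = \<Phi> s"
      unfolding \<Phi>_def using e(1)
      by (intro eventually_at_rightI[of t "t + e"]) auto
    have "(x \<longlongrightarrow> b ^ impulses_at T t * x t) (at_right t)"
      using x \<open>0 \<le> t\<close> by (simp add: is_trajectory_def)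
    moreover have "isCont H (b ^ impulses_at T t * x t)"
      using H[of "b ^ impulses_at T t * x t"] pos[of t] \<open>0 \<le> t\<close> b_pos by (auto intro: DERIV_isCont)
    ultimately have "((\<lambda>s. H (x s)) \<longlongrightarrow> H (b ^ impulses_at T t * x t)) (at_right t)"
      by (metis isCont_tendsto_compose)
    then have "((\<lambda>s. H (x s) + (sum L (I t) + L t)) \<longlongrightarrow>
        H (b ^ impulses_at T t * x t) + (sum L (I t) + L t)) (at_right t)"
      by (intro tendsto_intros)
    then have "((\<lambda>s. H (x s) + (sum L (I t) + L t)) \<longlongrightarrow> \<Phi> t) (at_right t)"
      by (simp add: \<Phi>_def L_def add.commute)
    then show ?thesis
      using ev by (rule Lim_transform_eventually)
  qed
  have cont: "continuous_on {0..\<tau>} \<Phi>"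
    unfolding continuous_on_def
  proof
    fix t assume t: "t \<in> {0..\<tau>}"
    show "(\<Phi> \<longlongrightarrow> \<Phi> t) (at t within {0..\<tau>})"
    proof (cases "t = 0")
      case True
      have "at 0 within {0..\<tau>} \<le> at_right (0::real)"
        unfolding at_within_def
        by (intro inf_mono order_refl) auto
      with True right[of 0] show ?thesis
        by (metis order_refl tendsto_mono)
    next
      case False
      then have "(\<Phi> \<longlongrightarrow> \<Phi> t) (at t)"
        using t left[of t] right[of t] by (simp add: filterlim_split_at)
      then show ?thesis
        by (rule tendsto_within_subset) auto
    qed
  qed
  have der: "(\<Phi> has_vector_derivative H' (x t) * (a * x t powr \<gamma>)) (at t)"
    if t: "t \<in> {0<..<\<tau>} - I \<tau>" for t
  proof -
    obtain e where e: "e > 0" "\<And>s. s \<in> impulse_times T \<Longrightarrow> s \<noteq> t \<Longrightarrow> e \<le> \<bar>s - t\<bar>"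
      using impulse_free_neighbourhood[OF T] by blast
    have no: "t \<notin> impulse_times T"
      using t by (auto simp: I_def)
    then have n: "impulses_at T t = 0"
      using t by (auto simp: impulse_times_def)
    have "H (x s) + sum L (I t) = \<Phi> s" if "s \<in> {t - e<..<t + e}" for s
    proof -
      have "I s = I t"
        using that e(2) no by (force simp: I_def)
      then show ?thesis
        by (simp add: \<Phi>_def)
    qed
    then have ev: "\<forall>\<^sub>F s in nhds t. H (x s) + sum L (I t) = \<Phi> s"
      using eventually_nhds_in_open[of "{t - e<..<t + e}" t] e(1) by (auto elim: eventually_mono)
    have dx: "(x has_real_derivative a * x t powr \<gamma>) (at t)"
      using x t n by (auto simp: is_trajectory_def)
    have "((\<lambda>s. H (x s)) has_real_derivative H' (x t) * (a * x t powr \<gamma>)) (at t)"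
      using DERIV_chain2[OF H[OF pos] dx] t by auto
    then have "((\<lambda>s. H (x s) + sum L (I t)) has_real_derivative H' (x t) * (a * x t powr \<gamma>)) (at t)"
      by (auto intro!: derivative_eq_intros)
    then have "(\<Phi> has_real_derivative H' (x t) * (a * x t powr \<gamma>)) (at t)"
      using DERIV_cong_ev[OF refl ev refl] by simp
    then show ?thesis
      by (simp add: has_real_derivative_iff_has_vector_derivative)
  qed
  \<comment> \<open>The impulse times before \<open>\<tau>\<close> form the finite exceptional set
    of the fundamental theorem, on which continuity of \<open>\<Phi>\<close> is enough.\<close>
  have "((\<lambda>t. H' (x t) * (a * x t powr \<gamma>)) has_integral (\<Phi> \<tau> - \<Phi> 0)) {0..\<tau>}"
    by (rule fundamental_theorem_of_calculus_interior_strong[OF fin[of \<tau>] tau _ cont]) (rule der)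
  moreover have "I 0 = {}"
    by (auto simp: I_def impulse_times_def)
  moreover have "x 0 = x0"
    using x by (simp add: is_trajectory_def)
  ultimately show ?thesis
    by (simp add: \<Phi>_def I_def L_def add_diff_eq diff_add_eq)
qed


text \<open>One formula serves three integrals: \<open>q = 0\<close> gives elapsed time,
  \<open>q = 1\<close> the resource and \<open>q = 1 - \<alpha>\<close> the utility. It also
  supplies their integrability.\<close>

lemma antipow_along_trajectory:
  assumes T: "T \<in> policies" and x: "traj x0 T x" and tau: "0 \<le> \<tau>"
  shows "((\<lambda>t. x t powr q) has_integral
      ((antipow (q + 1 - \<gamma>) (x \<tau>) - antipow (q + 1 - \<gamma>) x0 +
        (\<Sum>s\<in>impulse_times T \<inter> {..<\<tau>}.
          antipow (q + 1 - \<gamma>) (x s) - antipow (q + 1 - \<gamma>) (b ^ impulses_at T s * x s))) / a)) {0..\<tau>}"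
proof -
  define H where "H y = antipow (q + 1 - \<gamma>) y / a" for y
  have H: "(H has_real_derivative y powr (q - \<gamma>) / a) (at y)" if "y > 0" for y
    unfolding H_def using DERIV_cdivide[OF antipow_deriv[OF that, of "q + 1 - \<gamma>"], of a] by simp
  have eq: "x t powr (q - \<gamma>) / a * (a * x t powr \<gamma>) = x t powr q" if "t \<in> {0..\<tau>}" for t
    using a_pos trajectory_pos[OF x, of t] that by (simp flip: powr_add)
  have "((\<lambda>t. x t powr (q - \<gamma>) / a * (a * x t powr \<gamma>)) has_integral
      (H (x \<tau>) - H x0 +
        (\<Sum>s\<in>impulse_times T \<inter> {..<\<tau>}. H (x s) - H (b ^ impulses_at T s * x s)))) {0..\<tau>}"
    by (rule integral_along_trajectory[OF T x tau H])
  then have "((\<lambda>t. x t powr q) has_integral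
      (H (x \<tau>) - H x0 +
        (\<Sum>s\<in>impulse_times T \<inter> {..<\<tau>}. H (x s) - H (b ^ impulses_at T s * x s)))) {0..\<tau>}"
    by (rule has_integral_eq[rotated]) (use eq in auto)
  then show ?thesis
    by (simp add: H_def flip: diff_divide_distrib sum_divide_distrib add_divide_distrib)
qed

text \<open>In the coordinate \<open>antipow (1 - \<gamma>)\<close> the rate moves with constant
  speed \<open>a\<close>. The proof subtracts the time identity (\<open>q = 0\<close>) at
  \<open>s\<close> from the one at \<open>t\<close>; only the loss at \<open>s\<close> itself
  remains. Impulses at \<open>t\<close> are allowed, since \<open>x t\<close> precedes them.\<close>

lemma flow_between_impulses:
  assumes T: "T \<in> policies" and x: "traj x0 T x" and s: "0 \<le> s" "s < t"
    and free: "\<And>r. s < r \<Longrightarrow> r < t \<Longrightarrow> impulses_at T r = 0"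
  shows "antipow (1 - \<gamma>) (x t) = antipow (1 - \<gamma>) (b ^ impulses_at T s * x s) + a * (t - s)"
proof -
  define L where "L r = antipow (1 - \<gamma>) (x r) - antipow (1 - \<gamma>) (b ^ impulses_at T r * x r)" for r
  have time: "a * r = antipow (1 - \<gamma>) (x r) - antipow (1 - \<gamma>) x0 + sum L (impulse_times T \<inter> {..<r})"
    if r: "0 \<le> r" for r
  proof -
    have "((\<lambda>_. 1) has_integral r) {0..r}"
      using has_integral_const_real[of "1::real" 0 r] r by simp
    then have "((\<lambda>t. x t powr 0) has_integral r) {0..r}"
      by (rule has_integral_eq[rotated]) (use trajectory_pos[OF x] in force)
    from has_integral_unique[OF this antipow_along_trajectory[OF T x r, of 0]] show ?thesis
      using a_pos by (simp add: L_def field_simps)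
  qed
  have "sum L (impulse_times T \<inter> {..<t}) = sum L (impulse_times T \<inter> {..<s}) + L s"
  proof (cases "s \<in> impulse_times T")
    case True
    have "impulse_times T \<inter> {..<t} = insert s (impulse_times T \<inter> {..<s})"
    proof (intro equalityI subsetI)
      fix r assume "r \<in> impulse_times T \<inter> {..<t}"
      then show "r \<in> insert s (impulse_times T \<inter> {..<s})"
        using free[of r] by (cases r s rule: linorder_cases) (auto simp: impulse_times_def)
    qed (use True s in auto)
    then show ?thesis
      using finite_impulse_times_less[OF T, of s] by simp
  next
    case False
    have "impulse_times T \<inter> {..<t} = impulse_times T \<inter> {..<s}"
    proof (intro equalityI subsetI)
      fix r assume "r \<in> impulse_times T \<inter> {..<t}"
      then show "r \<in> impulse_times T \<inter> {..<s}"
        using free[of r] False by (cases r s rule: linorder_cases) (auto simp: impulse_times_def)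
    qed (use s in auto)
    with False s show ?thesis
      by (simp add: L_def impulse_times_def)
  qed
  with time[of t] time[of s] s show ?thesis
    by (simp add: L_def algebra_simps)
qed

lemma flow_eq:
  assumes "T \<in> policies" "traj x0 T x" "S \<in> policies" "traj y0 S y" "0 \<le> s" "s < t"
    and "\<And>r. s < r \<Longrightarrow> r < t \<Longrightarrow> impulses_at T r = 0 \<and> impulses_at S r = 0"
    and "x s = y s" "impulses_at T s = impulses_at S s"
  shows "x t = y t"
proof (rule antipow_inj)
  show "antipow (1 - \<gamma>) (x t) = antipow (1 - \<gamma>) (y t)"
    using flow_between_impulses[of T x0 x s t] flow_between_impulses[of S y0 y s t] assms by auto
qed (use assms trajectory_pos[of x0 T x t] trajectory_pos[of y0 S y t] in auto)

text \<open>Covers policies in feedback form, where the impulses are determined by the current state, as well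
  as \<open>S = T\<close>.\<close>

lemma trajectory_unique:
  assumes T: "T \<in> policies" "traj x0 T x" and S: "S \<in> policies" "traj x0 S y"
    and feedback: "\<And>t. 0 \<le> t \<Longrightarrow> x t = y t \<Longrightarrow> impulses_at T t = impulses_at S t"
    and "0 \<le> t"
  shows "x t = y t"
  using \<open>0 \<le> t\<close>
\<comment> \<open>Below, \<open>s\<close> is the last impulse time of either policy before
  \<open>t\<close>, or 0. The induction hypothesis gives \<open>x s = y s\<close>, feedback then
  gives equally many impulses at \<open>s\<close>, and the common flow carries the equality to
  \<open>t\<close>.\<close>
proof (induction "card ((impulse_times T \<union> impulse_times S) \<inter> {..<t})" arbitrary: t rule: less_induct)
  case less
  define E where "E r = (impulse_times T \<union> impulse_times S) \<inter> {..<r}" for r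
  have fin: "finite (E r)" for r
    using finite_impulse_times_less[OF T(1), of r] finite_impulse_times_less[OF S(1), of r]
    by (auto simp: E_def Int_Un_distrib2)
  define s where "s = Max (insert 0 (E t))"
  have init: "x 0 = y 0"
    using T S by (simp add: is_trajectory_def)
  show ?case
  proof (cases "t = 0")
    case True
    with init show ?thesis by simp
  next
    case False
    have s_in: "s \<in> insert 0 (E t)"
      unfolding s_def using fin by (intro Max_in) auto
    have s_max: "r \<le> s" if "r \<in> E t" for r
      unfolding s_def using fin that by simp
    have s: "0 \<le> s" "s < t"
      using s_in False less.prems by (auto simp: E_def impulse_times_def)
    have "x s = y s"
    proof (cases "s = 0")
      case True
      with init show ?thesis by simp
    next
      case False
      have "E s \<subset> E t"
        using s_in s False by (auto simp: E_def)
      then have "card (E s) < card (E t)"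
        using fin by (rule psubset_card_mono[rotated])
      then show ?thesis
        using less.hyps[of s] s by (simp add: E_def)
    qed
    moreover have "impulses_at T r = 0 \<and> impulses_at S r = 0" if "s < r" "r < t" for r
    proof -
      have "r \<notin> E t"
        using s_max[of r] that by force
      with that s show ?thesis
        by (auto simp: E_def impulse_times_def)
    qed
    ultimately show ?thesis
      using flow_eq[OF T S s] feedback[OF s(1)] by blast
  qed
qed

section \<open>Existence of trajectories, by gluing explicit solutions of the differential
  equation\<close>

definition flow :: "real \<Rightarrow> real \<Rightarrow> real" where
  "flow s x = (if \<gamma> = 1 then x * exp (a * s)
     else (x powr (1 - \<gamma>) + a * (1 - \<gamma>) * s) powr (1 / (1 - \<gamma>)))"

lemma flow_base_pos:
  assumes "0 < x" "0 \<le> s"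
  shows "0 < x powr (1 - \<gamma>) + a * (1 - \<gamma>) * s"
  using assms a_pos gamma by (intro add_pos_nonneg) auto

lemma flow_pos:
  assumes "0 < x" "0 \<le> s"
  shows "0 < flow s x"
  using assms flow_base_pos[OF assms] by (auto simp: flow_def)

lemma flow_0: "0 < x \<Longrightarrow> flow 0 x = x"
  using gamma by (simp add: flow_def powr_powr)

lemma flow_deriv:
  assumes "0 < x" "0 \<le> s"
  shows "((\<lambda>s. flow s x) has_real_derivative a * flow s x powr \<gamma>) (at s)"
proof (cases "\<gamma> = 1")
  case True
  with assms show ?thesis
    unfolding flow_def by (auto simp: abs_mult intro!: derivative_eq_intros)
next
  case False
  have "1 / (1 - \<gamma>) - 1 = \<gamma> / (1 - \<gamma>)"
    using False by (simp add: field_simps)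
  then show ?thesis
    using False flow_base_pos[OF assms]
    by (auto simp: flow_def powr_powr intro!: derivative_eq_intros)
qed

text \<open>Segment 0 starts at time 0 and segment \<open>n + 1\<close> at the impulse
  \<open>T n\<close>. \<open>enn2real\<close> sends an infinite \<open>T n\<close> to 0, but a
  trajectory only visits segments begun by a finite impulse.\<close>

primrec jump_time :: "(nat \<Rightarrow> ennreal) \<Rightarrow> nat \<Rightarrow> real" where
  "jump_time T 0 = 0"
| "jump_time T (Suc n) = enn2real (T n)"

text \<open>The value at the start of a segment, after one factor \<open>b\<close>. Simultaneous
  impulses yield segments of length 0, so that their factors accumulate one by one.\<close>

primrec jump_state :: "real \<Rightarrow> (nat \<Rightarrow> ennreal) \<Rightarrow> nat \<Rightarrow> real" where
  "jump_state x0 T 0 = x0"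
| "jump_state x0 T (Suc n) = b * flow (enn2real (T n) - jump_time T n) (jump_state x0 T n)"

lemma ex_trajectory:
  assumes T: "T \<in> policies" and x0: "x0 > 0"
  shows "\<exists>x. traj x0 T x"
proof -
  \<comment> \<open>Counting impulses strictly before \<open>t\<close> gives the index of the
    segment that is current at \<open>t\<close>, and makes \<open>x\<close> left-continuous.\<close>
  define N where "N t = card {n. T n < ennreal t}" for t
  define x where "x t = flow (t - jump_time T (N t)) (jump_state x0 T (N t))" for t
  have mono: "T m \<le> T n" if "m \<le> n" for m n
    using T that by (auto simp: policies_def incseq_def)
  have fin: "finite {n. T n < ennreal t}" for t
    by (rule finite_subset[OF _ finite_indices_le[OF T, of t]]) auto
  have less_iff: "T n < ennreal t \<longleftrightarrow> n < N t" for n t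
  proof -
    have "\<exists>k. {n. T n < ennreal t} = {..<k}"
    proof (cases "{n. T n < ennreal t} = {}")
      case True
      then show ?thesis by (intro exI[of _ 0]) auto
    next
      case False
      define M where "M = Max {n. T n < ennreal t}"
      have "T M < ennreal t"
        using Max_in[OF fin False] by (simp add: M_def)
      moreover have "n \<le> M" if "T n < ennreal t" for n
        unfolding M_def using fin that by simp
      ultimately have "T n < ennreal t \<longleftrightarrow> n < Suc M" for n
        using mono[of n M] by (auto simp: less_Suc_eq_le intro: le_less_trans)
      then show ?thesis by (intro exI[of _ "Suc M"]) auto
    qed
    then obtain k where k: "{n. T n < ennreal t} = {..<k}" ..
    then have "N t = k" by (simp add: N_def)
    with k show ?thesis by auto
  qed
  have time: "jump_time T n \<le> t \<and> (0 < t \<longrightarrow> jump_time T n < t)" if "n \<le> N t" "0 \<le> t" for n t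
  proof (cases n)
    case (Suc k)
    then have "T k < ennreal t"
      using that less_iff by auto
    with Suc that show ?thesis
      by (cases "T k") (auto simp: ennreal_less_iff)
  qed (use that in auto)
  have finT: "T n = ennreal (jump_time T (Suc n))" if "n < N t" for n t
    using that less_iff[of n t] by (cases "T n") auto
  have state: "0 < jump_state x0 T n \<and> jump_time T n \<le> jump_time T (Suc n)" if "T n < \<infinity>" for n
    using that
  proof (induction n)
    case 0
    then show ?case using x0 by simp
  next
    case (Suc n)
    have le: "T n \<le> T (Suc n)"
      by (rule mono) simp
    with Suc have "0 < jump_state x0 T n \<and> jump_time T n \<le> jump_time T (Suc n)"
      by auto
    then have "0 < jump_state x0 T (Suc n)"
      using b_pos flow_pos by simp
    moreover have "jump_time T (Suc n) \<le> jump_time T (Suc (Suc n))"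
      using le Suc.prems by (simp add: enn2real_mono)
    ultimately show ?case by blast
  qed
  have state_pos: "0 < jump_state x0 T n" if "n \<le> N t" for n t
  proof (cases n)
    case (Suc k)
    then have "T k < ennreal t"
      using that less_iff by auto
    then have "T k < \<infinity>"
      by (rule less_trans) simp
    from state[OF this] Suc show ?thesis
      using b_pos flow_pos by simp
  qed (use x0 in simp)
  have cont: "isCont (\<lambda>s. flow (s - r) v) t" if "0 < v" "r \<le> t" for r v t
  proof -
    have "((\<lambda>s. flow (s - r) v) has_real_derivative a * flow (t - r) v powr \<gamma> * 1) (at t)"
      by (rule DERIV_chain2[OF flow_deriv]) (use that in \<open>auto intro!: derivative_eq_intros\<close>)
    then show ?thesis
      by (rule DERIV_isCont)
  qed
  have N_const: "N s = N t" if "{n. T n < ennreal s} = {n. T n < ennreal t}" for s t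
    using that by (simp add: N_def)
  have "traj x0 T x"
    unfolding is_trajectory_def
  proof (intro conjI allI impI)
    have "N 0 = 0" by (simp add: N_def)
    then show "x 0 = x0"
      using x0 by (simp add: x_def flow_0)
  next
    fix t :: real assume t: "0 \<le> t"
    show "0 < x t"
      unfolding x_def using time[OF order_refl t] state_pos[OF order_refl, of t]
      by (intro flow_pos) auto
  next
    fix t :: real assume t: "0 < t"
    define r where "r = jump_time T (N t)"
    have r: "r < t" "0 \<le> r"
      using time[of "N t" t] t by (auto simp: r_def) (cases "N t", auto)
    have "\<forall>\<^sub>F s in at_left t. flow (s - r) (jump_state x0 T (N t)) = x s"
    proof (rule eventually_at_leftI[OF _ r(1)])
      fix s assume s: "s \<in> {r<..<t}"
      have "T n < ennreal s" if "n < N t" for n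
      proof -
        have "n \<le> N t - 1" "N t - 1 < N t"
          using that by auto
        then have "T n \<le> ennreal r"
          using mono[of n "N t - 1"] finT[of "N t - 1" t] that by (simp add: r_def)
        also have "\<dots> < ennreal s"
          using s r by (simp add: ennreal_less_iff)
        finally show ?thesis .
      qed
      moreover have "T n < ennreal t" if "T n < ennreal s" for n
        using that s r by (meson ennreal_leI greaterThanLessThan_iff less_eq_real_def order_less_le_trans)
      ultimately have "N s = N t"
        using less_iff by (intro N_const) auto
      then show "flow (s - r) (jump_state x0 T (N t)) = x s"
        by (simp add: x_def r_def)
    qed
    moreover have "((\<lambda>s. flow (s - r) (jump_state x0 T (N t))) \<longlongrightarrow> x t) (at_left t)"
      using cont[of "jump_state x0 T (N t)" r t] state_pos[of "N t" t] r
      by (auto simp: isCont_def x_def r_def filterlim_at_split)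
    ultimately show "(x \<longlongrightarrow> x t) (at_left t)"
      by (rule Lim_transform_eventually[rotated])
  next
    fix t :: real assume t: "0 \<le> t"
    define m where "m = impulses_at T t"
    obtain e where e: "e > 0" "\<And>s. s \<in> impulse_times T \<Longrightarrow> s \<noteq> t \<Longrightarrow> e \<le> \<bar>s - t\<bar>"
      using impulse_free_neighbourhood[OF T] by blast
    have Ns: "N s = N t + m" if s: "s \<in> {t<..<t + e}" for s
    proof -
      have "{n. T n < ennreal s} = {n. T n < ennreal t} \<union> {n. T n = ennreal t}"
      proof (intro equalityI subsetI)
        fix n assume n: "n \<in> {n. T n < ennreal s}"
        then obtain r where r: "0 \<le> r" "T n = ennreal r"
          by (cases "T n") auto
        then have rs: "r < s"
          using n by (simp add: ennreal_less_iff)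
        have "r \<in> impulse_times T"
          using impulse_timesI[OF T r] .
        then have "r \<le> t"
          using e(2)[of r] rs s by force
        with r show "n \<in> {n. T n < ennreal t} \<union> {n. T n = ennreal t}"
          by (auto simp: ennreal_less_iff)
      next
        fix n assume "n \<in> {n. T n < ennreal t} \<union> {n. T n = ennreal t}"
        then have "T n \<le> ennreal t" by auto
        also have "\<dots> < ennreal s"
          using s t by (simp add: ennreal_less_iff)
        finally show "n \<in> {n. T n < ennreal s}" by simp
      qed
      then show ?thesis
        unfolding N_def m_def impulses_at_def
        using fin finite_indices_eq[OF T, of t] by (subst card_Un_disjoint[symmetric]) auto
    qed
    \<comment> \<open>The \<open>m\<close> impulses at \<open>t\<close> occupy the indices from
      \<open>N t\<close> to \<open>N t + m - 1\<close>. If one of these entries were later than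
      \<open>t\<close>, monotonicity would leave fewer than \<open>m\<close> indices for the time
      \<open>t\<close>.\<close>
    have Tt: "T n = ennreal t" if "N t \<le> n" "n < N t + m" for n
    proof (rule antisym)
      show "ennreal t \<le> T n"
        using that less_iff[of n t] by simp
      show "T n \<le> ennreal t"
      proof (rule ccontr)
        assume "\<not> T n \<le> ennreal t"
        then have "T n > ennreal t" by simp
        then have "N t \<le> k \<and> k < n" if "T k = ennreal t" for k
          using that less_iff[of k t] mono[of n k] by (metis less_irrefl linorder_not_less order_less_le_trans)
        then have "{k. T k = ennreal t} \<subseteq> {N t..<n}"
          by auto
        then have "m \<le> card {N t..<n}"
          unfolding m_def impulses_at_def by (intro card_mono) auto
        with that show False by simp
      qed
    qed
    \<comment> \<open>Induction through the segments of length 0 at time \<open>t\<close>; for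
      \<open>j = m\<close> this identifies the right limit.\<close>
    have post: "flow (t - jump_time T (N t + j)) (jump_state x0 T (N t + j)) = b ^ j * x t \<and>
        jump_time T (N t + j) \<le> t \<and> 0 < jump_state x0 T (N t + j)" if "j \<le> m" for j
      using that
    proof (induction j)
      case 0
      show ?case
        using time[OF order_refl t] state_pos[OF order_refl] by (simp add: x_def)
    next
      case (Suc j)
      then have IH: "flow (t - jump_time T (N t + j)) (jump_state x0 T (N t + j)) = b ^ j * x t"
        "jump_time T (N t + j) \<le> t" "0 < jump_state x0 T (N t + j)"
        by auto
      have "T (N t + j) = ennreal t"
        using Suc.prems by (intro Tt) auto
      with t IH have "jump_time T (N t + Suc j) = t"
        "jump_state x0 T (N t + Suc j) = b ^ Suc j * x t"
        by auto
      moreover have "0 < b ^ j * x t"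
        using flow_pos[OF IH(3), of "t - jump_time T (N t + j)"] IH(1,2) by simp
      then have "0 < b ^ Suc j * x t"
        using b_pos by (simp add: mult.assoc)
      ultimately show ?case
        by (simp only: flow_0 diff_self order_refl simp_thms)
    qed
    have post: "flow (t - jump_time T (N t + m)) (jump_state x0 T (N t + m)) = b ^ m * x t"
        "jump_time T (N t + m) \<le> t" "0 < jump_state x0 T (N t + m)"
      using post[of m] by auto
    have "\<forall>\<^sub>F s in at_right t. flow (s - jump_time T (N t + m)) (jump_state x0 T (N t + m)) = x s"
      using e(1) Ns by (intro eventually_at_rightI[of t "t + e"]) (auto simp: x_def)
    moreover have "((\<lambda>s. flow (s - jump_time T (N t + m)) (jump_state x0 T (N t + m))) \<longlongrightarrow> b ^ m * x t) (at_right t)"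
      using cont[OF post(3,2)] unfolding isCont_def filterlim_at_split post(1) by simp
    ultimately show "(x \<longlongrightarrow> b ^ impulses_at T t * x t) (at_right t)"
      unfolding m_def by (rule Lim_transform_eventually[rotated])
  next
    fix t :: real assume t: "0 < t" and no: "impulses_at T t = 0"
    define r where "r = jump_time T (N t)"
    have r: "r < t" "0 < jump_state x0 T (N t)"
      using time[of "N t" t] t state_pos[of "N t" t] by (auto simp: r_def)
    obtain e where e: "e > 0" "\<And>s. s \<in> impulse_times T \<Longrightarrow> s \<noteq> t \<Longrightarrow> e \<le> \<bar>s - t\<bar>"
      using impulse_free_neighbourhood[OF T] by blast
    have Ns: "N s = N t" if s: "s \<in> {max 0 (t - e)<..<t + e}" for s
    proof (rule N_const, intro Collect_cong)
      fix n
      show "T n < ennreal s \<longleftrightarrow> T n < ennreal t"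
      proof (cases "T n")
        case (real u)
        then have u: "u \<in> impulse_times T"
          using impulse_timesI[OF T] by blast
        with no have "u \<noteq> t"
          by (auto simp: impulse_times_def)
        with e(2)[OF u] s have "u < s \<longleftrightarrow> u < t"
          by (auto simp: abs_if split: if_splits)
        with real s t show ?thesis
          by (simp add: ennreal_less_iff)
      qed simp
    qed
    have "flow (s - r) (jump_state x0 T (N t)) = x s" if "s \<in> {max 0 (t - e)<..<t + e}" for s
      unfolding x_def Ns[OF that] r_def ..
    then have ev: "\<forall>\<^sub>F s in nhds t. flow (s - r) (jump_state x0 T (N t)) = x s"
      using eventually_nhds_in_open[of "{max 0 (t - e)<..<t + e}" t] e(1) t by (auto elim: eventually_mono)
    have "((\<lambda>s. flow (s - r) (jump_state x0 T (N t))) has_real_derivative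
        a * flow (t - r) (jump_state x0 T (N t)) powr \<gamma> * 1) (at t)"
      by (rule DERIV_chain2[OF flow_deriv]) (use r in \<open>auto intro!: derivative_eq_intros\<close>)
    moreover have "x t = flow (t - r) (jump_state x0 T (N t))"
      by (simp add: x_def r_def)
    ultimately show "(x has_real_derivative a * x t powr \<gamma>) (at t)"
      using DERIV_cong_ev[OF refl ev refl] by simp
  qed
  then show ?thesis by blast
qed

lemma is_trajectory_trajectory:
  assumes "T \<in> policies" "x0 > 0"
  shows "traj x0 T (trajectory a \<gamma> b x0 T)"
  unfolding trajectory_def using ex_trajectory[OF assms] by (rule someI_ex)

section \<open>Threshold policies\<close>

lemma LEAST_impulses_less:
  assumes "0 < xbar"
  shows "b ^ (LEAST m. b ^ m * y < xbar) * y < xbar"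
proof -
  have "(\<lambda>m. b ^ m * y) \<longlonglongrightarrow> 0 * y"
    using b_pos b_less by (intro tendsto_intros LIMSEQ_realpow_zero) auto
  then have "\<forall>\<^sub>F m in sequentially. b ^ m * y < xbar"
    by (rule order_tendstoD) (use assms in simp)
  then have "\<exists>m. b ^ m * y < xbar"
    by (auto simp: eventually_sequentially)
  then show ?thesis
    by (rule LeastI_ex)
qed

lemma LEAST_impulses_eq_0:
  assumes "0 < xbar"
  shows "(LEAST m. b ^ m * y < xbar) = 0 \<longleftrightarrow> y < xbar"
  using LEAST_impulses_less[OF assms, of y] by (auto simp: Least_equality)

lemma LEAST_impulses_eq_1: "0 < xbar \<Longrightarrow> (LEAST m. b ^ m * xbar < xbar) = 1"
  using b_less
  by (intro Least_equality) (auto simp: Suc_le_eq intro!: Nat.gr0I)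

text \<open>Under the threshold policy the rate, after the initial impulses, climbs to \<open>xbar\<close> in time
  \<open>t0\<close> and from then on cycles from \<open>b * xbar\<close> to \<open>xbar\<close> with period \<open>p\<close>.\<close>

lemma ex_threshold_policy:
  assumes x0: "x0 > 0" and xbar: "xbar > 0"
  shows "\<exists>T l. is_threshold_policy a \<gamma> b x0 xbar T \<and> l > 0 \<and>
    (\<forall>t>0. l \<le> trajectory a \<gamma> b x0 T t \<and> trajectory a \<gamma> b x0 T t \<le> xbar)"
proof -
  let ?A = "antipow (1 - \<gamma>)"
  define m0 where "m0 = (LEAST m. b ^ m * x0 < xbar)"
  define y0 where "y0 = b ^ m0 * x0"
  have y0: "0 < y0" "y0 < xbar"
    using x0 b_pos LEAST_impulses_less[OF xbar, of x0] by (auto simp: y0_def m0_def)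
  have bx: "0 < b * xbar" "b * xbar < xbar"
    using b_pos b_less xbar by auto
  define t0 where "t0 = (?A xbar - ?A y0) / a"
  define p where "p = (?A xbar - ?A (b * xbar)) / a"
  have t0: "0 < t0" "?A xbar = ?A y0 + a * t0"
    using antipow_less[OF y0, of "1 - \<gamma>"] a_pos by (auto simp: t0_def)
  have p: "0 < p" "?A xbar = ?A (b * xbar) + a * p"
    using antipow_less[OF bx, of "1 - \<gamma>"] a_pos by (auto simp: p_def)
  define hit where "hit j = t0 + real j * p" for j
  have hit_pos: "0 < hit j" for j
    using t0 p by (simp add: hit_def add_pos_nonneg)
  have hit_less: "hit i < hit j \<longleftrightarrow> i < j" for i j
    using p by (simp add: hit_def)
  have hit_inj: "hit i = hit j \<longleftrightarrow> i = j" for i j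
    using p by (simp add: hit_def)
  \<comment> \<open>The candidate lists \<open>m0\<close> impulses at time 0 and then one at each
    hitting time of \<open>xbar\<close>. It is fixed before its trajectory is computed, so the
    feedback condition becomes something to verify.\<close>
  define T where "T n = (if n < m0 then 0 else ennreal (hit (n - m0)))" for n
  have T: "T \<in> policies"
    unfolding policies_def
  proof (intro CollectI conjI)
    show "incseq T"
      unfolding incseq_def
    proof (intro allI impI)
      fix m n :: nat assume "m \<le> n"
      then have "hit (m - m0) \<le> hit (n - m0)"
        using hit_less[of "n - m0" "m - m0"] by (metis diff_le_mono not_le)
      with \<open>m \<le> n\<close> show "T m \<le> T n"
        by (auto simp: T_def intro: ennreal_leI)
    qed
    have "filterlim hit at_top sequentially"
      unfolding hit_def using p(1)
      by (intro filterlim_tendsto_add_at_top[OF tendsto_const]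
          filterlim_at_top_mult_tendsto_pos[OF tendsto_const] filterlim_real_sequentially)
    then have "(\<lambda>n. ennreal (hit n)) \<longlonglongrightarrow> \<infinity>"
      by (simp add: ennreal_tendsto_top_eq_at_top)
    then have "(\<lambda>n. T (n + m0)) \<longlonglongrightarrow> \<infinity>"
      by (simp add: T_def)
    then show "T \<longlonglongrightarrow> \<infinity>"
      by (rule LIMSEQ_offset)
  qed
  have at_0: "impulses_at T 0 = m0"
  proof -
    have "T n = ennreal 0 \<longleftrightarrow> n < m0" for n
      using hit_pos[of "n - m0"] by (auto simp: T_def not_le ennreal_eq_0_iff)
    then show ?thesis by (simp add: impulses_at_def)
  qed
  have at_hit: "impulses_at T (hit j) = 1" for j
  proof -
    have "T n = ennreal (hit j) \<longleftrightarrow> n = m0 + j" for n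
      using hit_pos[of j] hit_pos[of "n - m0"] hit_inj[of "n - m0" j] by (auto simp: T_def)
    then show ?thesis by (simp add: impulses_at_def)
  qed
  have at_other: "impulses_at T t = 0" if "0 < t" "\<And>j. t \<noteq> hit j" for t
  proof -
    have "T n \<noteq> ennreal t" for n
      using that hit_pos[of "n - m0"] by (auto simp: T_def)
    then show ?thesis by (simp add: impulses_at_def)
  qed
  define x where "x = trajectory a \<gamma> b x0 T"
  have x: "traj x0 T x"
    unfolding x_def by (rule is_trajectory_trajectory[OF T x0])
  have x_0: "x 0 = x0"
    using x by (simp add: is_trajectory_def)
  have x_pos: "0 < x t" if "0 \<le> t" for t
    using trajectory_pos[OF x that] .
  have first: "?A (x t) = ?A y0 + a * t" if "0 < t" "t \<le> t0" for t
  proof -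
    have "impulses_at T r = 0" if "0 < r" "r < t" for r
    proof (rule at_other)
      fix j
      have "t0 \<le> hit j" using p by (simp add: hit_def)
      with that \<open>t \<le> t0\<close> show "r \<noteq> hit j" by simp
    qed (use that in simp)
    with flow_between_impulses[OF T x _ \<open>0 < t\<close>] show ?thesis
      by (simp add: at_0 x_0 y0_def)
  qed
  have later: "?A (x t) = ?A (b * xbar) + a * (t - hit j)"
    if "hit j < t" "t \<le> hit (Suc j)" "x (hit j) = xbar" for t j
  proof -
    have "impulses_at T r = 0" if r: "hit j < r" "r < t" for r
    proof (rule at_other)
      fix i
      show "r \<noteq> hit i"
        using r \<open>t \<le> hit (Suc j)\<close> hit_less[of j i] hit_less[of i "Suc j"] by auto
    qed (use r hit_pos[of j] in simp)
    with flow_between_impulses[OF T x _ \<open>hit j < t\<close>] hit_pos[of j] that(3) show ?thesis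
      by (simp add: at_hit)
  qed
  have x_hit: "x (hit j) = xbar" for j
  proof (induction j)
    case 0
    have "hit 0 = t0" by (simp add: hit_def)
    moreover have "?A (x t0) = ?A xbar"
      using first[of t0] t0 by simp
    ultimately show ?case
      using t0 xbar by (metis antipow_inj less_imp_le x_pos)
  next
    case (Suc j)
    have "hit (Suc j) - hit j = p"
      by (simp add: hit_def algebra_simps)
    with later[of j "hit (Suc j)"] Suc p(2) hit_less[of j "Suc j"]
    have "?A (x (hit (Suc j))) = ?A xbar"
      by (simp only: order_refl lessI)
    then show ?case
      using hit_pos[of "Suc j"] xbar by (metis antipow_inj less_imp_le x_pos)
  qed
  have antipow_le: "u \<le> v" if "?A u \<le> ?A v" "0 < u" "0 < v" for u v
    using antipow_less[of v u "1 - \<gamma>"] that by (cases "u \<le> v") auto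
  have antipow_lt: "u < v" if "?A u < ?A v" "0 < u" "0 < v" for u v
    using antipow_less[of v u "1 - \<gamma>"] that by (cases u v rule: linorder_cases) auto
  \<comment> \<open>Strictness away from the hitting times is what makes the prescribed number of
    impulses 0 there.\<close>
  have range: "min y0 (b * xbar) \<le> x t \<and> (x t = xbar \<and> (\<exists>j. t = hit j) \<or> x t < xbar)"
    if t: "0 < t" for t
  proof (cases "t \<le> t0")
    case True
    have "y0 \<le> x t"
      using first[OF t True] t a_pos y0 x_pos[of t] by - (rule antipow_le, auto)
    moreover have "x t = xbar \<and> t = hit 0" if "t = t0"
      using x_hit[of 0] that by (simp add: hit_def)
    moreover have "x t < xbar" if "t < t0"
      using first[OF t True] t a_pos xbar x_pos[of t] that t0 by - (rule antipow_lt, auto)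
    ultimately show ?thesis
      using True by (metis le_less min.coboundedI1)
  next
    case False
    \<comment> \<open>Ceiling minus one, and not the floor, puts \<open>t\<close> into the half-open
      interval from \<open>hit j\<close> (excluded) to \<open>hit (Suc j)\<close> (included), in
      line with left-continuity.\<close>
    define j where "j = nat (\<lceil>(t - t0) / p\<rceil> - 1)"
    have "0 < (t - t0) / p"
      using False p by simp
    then have "real j = of_int \<lceil>(t - t0) / p\<rceil> - 1"
      by (simp add: j_def)
    then have "real j < (t - t0) / p" "(t - t0) / p \<le> real j + 1"
      by linarith+
    then have j: "hit j < t" "t \<le> hit (Suc j)"
      using p by (auto simp: hit_def field_simps)
    have eq: "?A (x t) = ?A (b * xbar) + a * (t - hit j)"
      using later[OF j x_hit] .
    have "b * xbar \<le> x t"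
      using eq j a_pos bx t x_pos[of t] by - (rule antipow_le, auto)
    moreover have "x t = xbar" if "t = hit (Suc j)"
      using x_hit that by simp
    moreover have "x t < xbar" if "t < hit (Suc j)"
    proof (rule antipow_lt)
      have "t - hit j < p"
        using that by (simp add: hit_def algebra_simps)
      then show "?A (x t) < ?A xbar"
        using eq p a_pos by simp
    qed (use x_pos t xbar in auto)
    ultimately show ?thesis
      using j by (metis le_less min.coboundedI2)
  qed
  have "is_threshold_policy a \<gamma> b x0 xbar T"
    unfolding is_threshold_policy_def x_def[symmetric]
  proof (intro conjI allI impI T)
    fix t :: real assume t: "0 \<le> t"
    consider "t = 0" | j where "t = hit j" | "0 < t" "\<And>j. t \<noteq> hit j"
      using t by fastforce
    then show "impulses_at T t = (LEAST m. b ^ m * x t < xbar)"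
    proof cases
      case 1
      then show ?thesis by (simp add: at_0 x_0 m0_def)
    next
      case 2
      then show ?thesis by (simp add: at_hit x_hit LEAST_impulses_eq_1[OF xbar])
    next
      case 3
      with range[OF 3(1)] have "x t < xbar" by auto
      then show ?thesis
        using LEAST_impulses_eq_0[OF xbar] at_other[OF 3] by simp
    qed
  qed
  moreover have "0 < min y0 (b * xbar)"
    using y0 bx by simp
  moreover have "\<forall>t>0. min y0 (b * xbar) \<le> x t \<and> x t \<le> xbar"
    using range by (metis less_imp_le order_refl)
  ultimately show ?thesis
    unfolding x_def by blast
qed

text \<open>The number of impulses is a function of the current state, so
  \<open>trajectory_unique\<close> compares two threshold policies before they are known to agree.
  Equal trajectories then force equal multiplicities.\<close>

lemma is_threshold_policy_unique:
  assumes x0: "x0 > 0" and T: "is_threshold_policy a \<gamma> b x0 xbar T" and S: "is_threshold_policy a \<gamma> b x0 xbar S"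
  shows "T = S"
proof (rule policy_eqI)
  show pol: "T \<in> policies" "S \<in> policies"
    using T S by (auto simp: is_threshold_policy_def)
  fix t :: real assume "0 \<le> t"
  moreover from this have "trajectory a \<gamma> b x0 T t = trajectory a \<gamma> b x0 S t"
    using T S
    by (intro trajectory_unique[OF pol(1) is_trajectory_trajectory[OF pol(1) x0]
          pol(2) is_trajectory_trajectory[OF pol(2) x0]])
      (auto simp: is_threshold_policy_def)
  ultimately show "impulses_at T t = impulses_at S t"
    using T S by (simp add: is_threshold_policy_def)
qed

text \<open>The bounds start after time 0 because the initial value may exceed \<open>xbar\<close>.
  The positive lower bound \<open>l\<close> is needed to keep \<open>antipow q\<close> of the rate
  bounded for exponents \<open>q \<le> 0\<close>.\<close>

lemma threshold_policy:
  assumes "x0 > 0" "xbar > 0"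
  shows "is_threshold_policy a \<gamma> b x0 xbar (threshold_policy a \<gamma> b x0 xbar)"
    and "\<exists>l>0. \<forall>t>0. l \<le> trajectory a \<gamma> b x0 (threshold_policy a \<gamma> b x0 xbar) t \<and>
      trajectory a \<gamma> b x0 (threshold_policy a \<gamma> b x0 xbar) t \<le> xbar"
proof -
  obtain T l where T: "is_threshold_policy a \<gamma> b x0 xbar T" "l > 0"
    "\<forall>t>0. l \<le> trajectory a \<gamma> b x0 T t \<and> trajectory a \<gamma> b x0 T t \<le> xbar"
    using ex_threshold_policy[OF assms] by blast
  have "threshold_policy a \<gamma> b x0 xbar = T"
    unfolding threshold_policy_def
    using T(1) is_threshold_policy_unique[OF assms(1) _ T(1)] by (rule the_equality)
  with T show "is_threshold_policy a \<gamma> b x0 xbar (threshold_policy a \<gamma> b x0 xbar)"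
    and "\<exists>l>0. \<forall>t>0. l \<le> trajectory a \<gamma> b x0 (threshold_policy a \<gamma> b x0 xbar) t \<and>
      trajectory a \<gamma> b x0 (threshold_policy a \<gamma> b x0 xbar) t \<le> xbar"
    by auto
qed

section \<open>Long-run averages under a threshold policy\<close>

lemma threshold_policy_in_policies: "x0 > 0 \<Longrightarrow> xbar > 0 \<Longrightarrow> threshold_policy a \<gamma> b x0 xbar \<in> policies"
  using threshold_policy(1) by (auto simp: is_threshold_policy_def)

text \<open>After time 0 every impulse is single and is applied exactly at level
  \<open>xbar\<close>, so all these losses coincide. The possibly multiple impulse at time 0 and the
  boundary terms contribute a bounded error.\<close>

lemma integral_threshold_policy:
  fixes x0 xbar q
  defines "T \<equiv> threshold_policy a \<gamma> b x0 xbar"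
  assumes x0: "x0 > 0" and xbar: "xbar > 0"
  shows "\<exists>K. \<forall>\<tau>>0. \<bar>integral {0..\<tau>} (\<lambda>t. trajectory a \<gamma> b x0 T t powr q) -
    real (card (impulse_times T \<inter> {0<..<\<tau>})) * (xbar powr (q + 1 - \<gamma>) * gap b (q + 1 - \<gamma>) / a)\<bar> \<le> K"
proof -
  let ?A = "antipow (q + 1 - \<gamma>)"
  define x where "x = trajectory a \<gamma> b x0 T"
  have thr: "is_threshold_policy a \<gamma> b x0 xbar T"
    unfolding T_def by (rule threshold_policy[OF x0 xbar])
  then have T: "T \<in> policies"
    by (simp add: is_threshold_policy_def)
  have x: "traj x0 T x"
    unfolding x_def by (rule is_trajectory_trajectory[OF T x0])
  obtain l where l: "l > 0" "\<And>t. t > 0 \<Longrightarrow> l \<le> x t" "\<And>t. t > 0 \<Longrightarrow> x t \<le> xbar"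
    using threshold_policy(2)[OF x0 xbar] by (auto simp: x_def T_def)
  define L where "L s = ?A (x s) - ?A (b ^ impulses_at T s * x s)" for s
  define D where "D = xbar powr (q + 1 - \<gamma>) * gap b (q + 1 - \<gamma>)"
  have L: "L s = D" if "s \<in> impulse_times T" "0 < s" for s
  proof -
    have n: "impulses_at T s = (LEAST m. b ^ m * x s < xbar)"
      using thr that by (simp add: is_threshold_policy_def x_def)
    then have "x s = xbar"
      using that l(3)[OF \<open>0 < s\<close>] LEAST_impulses_eq_0[OF xbar, of "x s"] by (simp add: impulse_times_def)
    with n show ?thesis
      using LEAST_impulses_eq_1[OF xbar] antipow_diff[OF b_pos xbar, of "q + 1 - \<gamma>"] by (simp add: L_def D_def)
  qed
  have antipow_le: "?A u \<le> ?A v" if "0 < u" "u \<le> v" for u v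
    using that antipow_less[of u v "q + 1 - \<gamma>"] by (cases "u = v") auto
  define K where "K = (\<bar>?A l\<bar> + \<bar>?A xbar\<bar> + \<bar>?A x0\<bar> + \<bar>L 0\<bar>) / a"
  have "\<bar>integral {0..\<tau>} (\<lambda>t. x t powr q) - real (card (impulse_times T \<inter> {0<..<\<tau>})) * (D / a)\<bar> \<le> K"
    if tau: "\<tau> > 0" for \<tau>
  proof -
    have "sum L (impulse_times T \<inter> {..<\<tau>}) = L 0 + sum L (impulse_times T \<inter> {0<..<\<tau>})"
    proof (cases "0 \<in> impulse_times T")
      case True
      then have "impulse_times T \<inter> {..<\<tau>} = insert 0 (impulse_times T \<inter> {0<..<\<tau>})"
        using tau by (auto simp: impulse_times_def)
      moreover have "finite (impulse_times T \<inter> {0<..<\<tau>})"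
        by (rule finite_subset[OF _ finite_impulse_times_less[OF T, of \<tau>]]) auto
      ultimately show ?thesis by simp
    next
      case False
      then have "0 < s" if "s \<in> impulse_times T" for s
        using that by (cases "s = 0") (auto simp: impulse_times_def)
      then have "impulse_times T \<inter> {..<\<tau>} = impulse_times T \<inter> {0<..<\<tau>}"
        by auto
      with False show ?thesis
        by (simp add: L_def impulse_times_def)
    qed
    also have "sum L (impulse_times T \<inter> {0<..<\<tau>}) = (\<Sum>s\<in>impulse_times T \<inter> {0<..<\<tau>}. D)"
      by (rule sum.cong) (auto simp: L)
    finally have "integral {0..\<tau>} (\<lambda>t. x t powr q) =
        (?A (x \<tau>) - ?A x0 + L 0 + real (card (impulse_times T \<inter> {0<..<\<tau>})) * D) / a"
      using integral_unique[OF antipow_along_trajectory[OF T x, of \<tau> q]] tau by (simp add: L_def)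
    then have "integral {0..\<tau>} (\<lambda>t. x t powr q) - real (card (impulse_times T \<inter> {0<..<\<tau>})) * (D / a) =
        (?A (x \<tau>) - ?A x0 + L 0) / a"
      by (simp add: add_divide_distrib)
    moreover have "?A l \<le> ?A (x \<tau>)" "?A (x \<tau>) \<le> ?A xbar"
      using antipow_le[OF l(1) l(2)[OF tau]] antipow_le[OF _ l(3)[OF tau]] trajectory_pos[OF x] tau by auto
    then have "\<bar>?A (x \<tau>) - ?A x0 + L 0\<bar> \<le> \<bar>?A l\<bar> + \<bar>?A xbar\<bar> + \<bar>?A x0\<bar> + \<bar>L 0\<bar>"
      by linarith
    ultimately show ?thesis
      unfolding K_def using a_pos by (simp add: divide_right_mono)
  qed
  then show ?thesis
    unfolding x_def D_def by (intro exI[of _ K]) simp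
qed

text \<open>The number of impulses is eliminated rather than computed: for \<open>q = 0\<close> the
  integral is \<open>\<tau>\<close>, and comparison with general \<open>q\<close> leaves the ratio
  of the integral over one cycle to the length of the cycle.\<close>

lemma average_threshold_policy:
  fixes x0 xbar q
  defines "T \<equiv> threshold_policy a \<gamma> b x0 xbar"
  assumes x0: "x0 > 0" and xbar: "xbar > 0"
  shows "((\<lambda>\<tau>. 1 / \<tau> * integral {0..\<tau>} (\<lambda>t. trajectory a \<gamma> b x0 T t powr q)) \<longlongrightarrow>
    xbar powr q * (gap b (q + 1 - \<gamma>) / gap b (1 - \<gamma>))) at_top"
proof -
  define I where "I r \<tau> = integral {0..\<tau>} (\<lambda>t. trajectory a \<gamma> b x0 T t powr r)" for r \<tau>
  define n where "n \<tau> = real (card (impulse_times T \<inter> {0<..<\<tau>}))" for \<tau>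
  define d where "d r = xbar powr (r + 1 - \<gamma>) * gap b (r + 1 - \<gamma>) / a" for r
  have T: "T \<in> policies"
    unfolding T_def by (rule threshold_policy_in_policies[OF x0 xbar])
  have x: "traj x0 T (trajectory a \<gamma> b x0 T)"
    by (rule is_trajectory_trajectory[OF T x0])
  obtain K where K: "\<And>\<tau>. \<tau> > 0 \<Longrightarrow> \<bar>I q \<tau> - n \<tau> * d q\<bar> \<le> K"
    using integral_threshold_policy[OF x0 xbar, of q] by (auto simp: I_def n_def d_def T_def)
  obtain K0 where K0: "\<And>\<tau>. \<tau> > 0 \<Longrightarrow> \<bar>I 0 \<tau> - n \<tau> * d 0\<bar> \<le> K0"
    using integral_threshold_policy[OF x0 xbar, of 0] by (auto simp: I_def n_def d_def T_def)
  have I_0: "I 0 \<tau> = \<tau>" if "\<tau> > 0" for \<tau>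
  proof -
    have "I 0 \<tau> = integral {0..\<tau>} (\<lambda>_. 1)"
      unfolding I_def by (rule integral_cong) (use trajectory_pos[OF x] in force)
    with that show ?thesis by simp
  qed
  have d0: "d 0 > 0"
    using gaps_pos xbar a_pos by (simp add: d_def)
  define r where "r = d q / d 0"
  have r: "r = xbar powr q * (gap b (q + 1 - \<gamma>) / gap b (1 - \<gamma>))"
  proof -
    have "xbar powr (q + 1 - \<gamma>) = xbar powr q * xbar powr (1 - \<gamma>)"
      by (simp add: add_diff_eq flip: powr_add)
    then show ?thesis
      using a_pos xbar by (simp add: r_def d_def)
  qed
  have bound: "\<bar>1 / \<tau> * I q \<tau> - r\<bar> \<le> (K + \<bar>r\<bar> * K0) * (1 / \<tau>)" if tau: "\<tau> > 0" for \<tau>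
  proof -
    have "I q \<tau> - r * \<tau> = (I q \<tau> - n \<tau> * d q) - r * (\<tau> - n \<tau> * d 0)"
      using d0 by (simp add: r_def algebra_simps)
    also have "\<bar>\<dots>\<bar> \<le> \<bar>I q \<tau> - n \<tau> * d q\<bar> + \<bar>r\<bar> * \<bar>\<tau> - n \<tau> * d 0\<bar>"
      by (metis abs_triangle_ineq4 abs_mult)
    also have "\<dots> \<le> K + \<bar>r\<bar> * K0"
      using K[OF tau] K0[OF tau] I_0[OF tau] by (intro add_mono mult_left_mono) auto
    finally have "\<bar>I q \<tau> - r * \<tau>\<bar> / \<tau> \<le> (K + \<bar>r\<bar> * K0) / \<tau>"
      using tau by (simp add: divide_right_mono)
    moreover have "\<bar>I q \<tau> - r * \<tau>\<bar> / \<tau> = \<bar>1 / \<tau> * I q \<tau> - r\<bar>"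
    proof -
      have "1 / \<tau> * I q \<tau> - r = (I q \<tau> - r * \<tau>) / \<tau>"
        using tau by (simp add: diff_divide_distrib)
      with tau show ?thesis
        by simp
    qed
    ultimately show ?thesis by simp
  qed
  have "((\<lambda>\<tau>::real. (K + \<bar>r\<bar> * K0) * (1 / \<tau>)) \<longlongrightarrow> 0) at_top"
    by real_asymp
  then have "((\<lambda>\<tau>. 1 / \<tau> * I q \<tau> - r) \<longlongrightarrow> 0) at_top"
    by (rule Lim_null_comparison[rotated])
      (use bound in \<open>auto intro!: eventually_mono[OF eventually_gt_at_top[of 0]]\<close>)
  then show ?thesis
    unfolding I_def r by (simp add: LIM_zero_iff)
qed

lemma G_obj_threshold_policy:
  assumes "x0 > 0" "xbar > 0"
  shows "G_obj a \<gamma> b x0 (return_pmf (threshold_policy a \<gamma> b x0 xbar)) =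
    ereal (xbar * (gap b (2 - \<gamma>) / gap b (1 - \<gamma>)))"
proof -
  define T where "T = threshold_policy a \<gamma> b x0 xbar"
  have T: "T \<in> policies"
    unfolding T_def by (rule threshold_policy_in_policies[OF assms])
  have "integral {0..\<tau>} (\<lambda>t. trajectory a \<gamma> b x0 T t powr 1) = integral {0..\<tau>} (trajectory a \<gamma> b x0 T)" for \<tau>
    by (rule integral_cong) (use trajectory_pos[OF is_trajectory_trajectory[OF T assms(1)]] in \<open>auto simp: less_imp_le\<close>)
  with average_threshold_policy[OF assms, of 1] have
    "((\<lambda>\<tau>. 1 / \<tau> * integral {0..\<tau>} (trajectory a \<gamma> b x0 T)) \<longlongrightarrow>
      xbar * (gap b (2 - \<gamma>) / gap b (1 - \<gamma>))) at_top"
    using assms by (simp add: T_def)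
  then show ?thesis
    unfolding G_obj_def T_def[symmetric]
    by (intro lim_imp_Limsup) auto
qed

lemma J_obj_threshold_policy:
  assumes "x0 > 0" "xbar > 0"
  shows "J_obj \<alpha> a \<gamma> b x0 (return_pmf (threshold_policy a \<gamma> b x0 xbar)) =
    ereal (xbar powr (1 - \<alpha>) / (1 - \<alpha>) * (gap b (2 - \<alpha> - \<gamma>) / gap b (1 - \<gamma>)))"
proof -
  define T where "T = threshold_policy a \<gamma> b x0 xbar"
  define I where "I \<tau> = integral {0..\<tau>} (\<lambda>t. trajectory a \<gamma> b x0 T t powr (1 - \<alpha>))" for \<tau>
  have "1 - \<alpha> + 1 - \<gamma> = 2 - \<alpha> - \<gamma>"
    by simp
  with average_threshold_policy[OF assms, of "1 - \<alpha>"]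
  have "((\<lambda>\<tau>. 1 / \<tau> * I \<tau>) \<longlongrightarrow> xbar powr (1 - \<alpha>) * (gap b (2 - \<alpha> - \<gamma>) / gap b (1 - \<gamma>))) at_top"
    by (simp only: I_def T_def)
  from tendsto_mult[OF this tendsto_const[of "1 / (1 - \<alpha>)"]]
  have "((\<lambda>\<tau>. 1 / \<tau> * (I \<tau> / (1 - \<alpha>))) \<longlongrightarrow>
      xbar powr (1 - \<alpha>) / (1 - \<alpha>) * (gap b (2 - \<alpha> - \<gamma>) / gap b (1 - \<gamma>))) at_top"
    by (simp add: mult.commute)
  then show ?thesis
    unfolding J_obj_def T_def[symmetric] by (intro lim_imp_Liminf) (auto simp: I_def)
qed
end

section \<open>The Lagrangian bound\<close>

text \<open>Concavity: for \<open>q \<le> 1\<close> the derivative \<open>z powr (q - 1)\<close> is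
  nonincreasing.\<close>

lemma antipow_tangent:
  assumes "q \<le> 1" "0 < x" "0 < y"
  shows "antipow q x \<le> antipow q y + y powr (q - 1) * (x - y)"
proof (cases x y rule: linorder_cases)
  case less
  obtain z where z: "x < z" "z < y" "antipow q y - antipow q x = (y - x) * z powr (q - 1)"
    using MVT2[OF less, of "antipow q" "\<lambda>z. z powr (q - 1)"] antipow_deriv assms by auto
  have "y powr (q - 1) \<le> z powr (q - 1)"
    using z assms by (intro powr_mono2') auto
  then have "(y - x) * y powr (q - 1) \<le> (y - x) * z powr (q - 1)"
    using less by (intro mult_left_mono) auto
  with z show ?thesis by (simp add: algebra_simps)
next
  case greater
  obtain z where z: "y < z" "z < x" "antipow q x - antipow q y = (x - y) * z powr (q - 1)"
    using MVT2[OF greater, of "antipow q" "\<lambda>z. z powr (q - 1)"] antipow_deriv assms by auto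
  have "z powr (q - 1) \<le> y powr (q - 1)"
    using z assms by (intro powr_mono2') auto
  then have "(x - y) * z powr (q - 1) \<le> (x - y) * y powr (q - 1)"
    using greater by (intro mult_left_mono) auto
  with z show ?thesis by (simp add: algebra_simps)
qed simp

text \<open>The pieces agree to first order at \<open>c\<close>, so the glued function is
  differentiable everywhere, as \<open>integral_along_trajectory\<close> requires of a value
  function.\<close>

lemma DERIV_linear_extension:
  fixes f :: "real \<Rightarrow> real"
  assumes "\<And>x. c \<le> x \<Longrightarrow> (f has_real_derivative f' x) (at x)"
  shows "((\<lambda>x. if x \<le> c then f c + f' c * (x - c) else f x) has_real_derivative
    (if x \<le> c then f' c else f' x)) (at x)"
proof -
  let ?h = "\<lambda>x. if x \<le> c then f c + f' c * (x - c) else f x"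
  consider "x < c" | "x = c" | "c < x" by linarith
  then show ?thesis
  proof cases
    case 1
    have "\<forall>\<^sub>F y in nhds x. f c + f' c * (y - c) = ?h y"
      using eventually_nhds_in_open[of "{..<c}" x] 1 by (auto elim!: eventually_mono)
    moreover have "((\<lambda>y. f c + f' c * (y - c)) has_real_derivative f' c) (at x)"
      by (auto intro!: derivative_eq_intros)
    ultimately show ?thesis
      using DERIV_cong_ev[OF refl _ refl] 1 by force
  next
    case 2
    have "((\<lambda>y. (?h y - ?h c) / (y - c)) \<longlongrightarrow> f' c) (at_left c)"
      by (rule Lim_transform_eventually[OF tendsto_const])
        (auto intro!: eventually_at_leftI[of "c - 1"])
    moreover have "((\<lambda>y. (f y - f c) / (y - c)) \<longlongrightarrow> f' c) (at_right c)"
      using assms[of c] by (auto simp: has_field_derivative_iff filterlim_at_split)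
    then have "((\<lambda>y. (?h y - ?h c) / (y - c)) \<longlongrightarrow> f' c) (at_right c)"
      by (rule Lim_transform_eventually) (auto intro!: eventually_at_rightI[of _ "c + 1"])
    ultimately show ?thesis
      using 2 by (simp only: has_field_derivative_iff filterlim_at_split order_refl if_True)
  next
    case 3
    have "\<forall>\<^sub>F y in nhds x. f y = ?h y"
      using eventually_nhds_in_open[of "{c<..}" x] 3 by (auto elim!: eventually_mono)
    moreover have "(f has_real_derivative f' x) (at x)"
      using assms 3 by simp
    ultimately show ?thesis
      using DERIV_cong_ev[OF refl _ refl] 3 by force
  qed
qed

context user
begin

text \<open>The relative value function \<open>h0\<close> of the threshold policy satisfies the optimality equation between
  impulses, but need not be bounded below near 0. There, impulses are no longer worthwhile, and it is
  replaced by an affine function below a small level \<open>y0\<close>, which keeps both optimality inequalities.\<close>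

lemma lagrangian_bound:
  fixes \<alpha> lam xbar :: real
  defines "c1 \<equiv> gap b (2 - \<alpha> - \<gamma>) / gap b (1 - \<gamma>)" and "c2 \<equiv> gap b (2 - \<gamma>) / gap b (1 - \<gamma>)"
  defines "\<rho> \<equiv> xbar powr (1 - \<alpha>) / (1 - \<alpha>) * c1 - lam * (xbar * c2)"
  assumes alpha: "\<alpha> > 0" "\<alpha> \<noteq> 1" and lam: "lam > 0" and xbar: "xbar > 0" and x0: "x0 > 0"
    and stationary: "c1 * xbar powr (- \<alpha>) = lam * c2"
  shows "\<exists>C. \<forall>T\<in>policies. \<forall>\<tau>>0.
    integral {0..\<tau>} (\<lambda>t. trajectory a \<gamma> b x0 T t powr (1 - \<alpha>) / (1 - \<alpha>)) \<le>
    \<rho> * \<tau> + lam * integral {0..\<tau>} (trajectory a \<gamma> b x0 T) + C"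
proof -
  define f where "f x = x powr (1 - \<alpha>) / (1 - \<alpha>) - lam * x" for x
  \<comment> \<open>\<open>f\<close> is the running reward of the Lagrangian and
    \<open>\<rho>\<close> the conjectured optimal average. \<open>h0\<close> is a primitive of
    \<open>\<phi>\<close>, which solves
    \<open>\<phi> x * (a * x powr \<gamma>) = \<rho> - f x\<close>.\<close>
  define h0 where "h0 x = (\<rho> * antipow (1 - \<gamma>) x - antipow (2 - \<alpha> - \<gamma>) x / (1 - \<alpha>) + lam * antipow (2 - \<gamma>) x) / a" for x
  define \<phi> where "\<phi> x = (\<rho> - f x) * x powr (- \<gamma>) / a" for x
  note gaps = gaps_pos
  have c_pos: "c1 > 0" "c2 > 0"
    using gaps by (auto simp: c1_def c2_def)
  have q_eq: "antipow (1 - \<alpha>) x = x powr (1 - \<alpha>) / (1 - \<alpha>)" for x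
    using alpha by (simp add: antipow_def)
  have tangent: "x powr (1 - \<alpha>) / (1 - \<alpha>) \<le> y powr (1 - \<alpha>) / (1 - \<alpha>) + y powr (- \<alpha>) * (x - y)"
    if "0 < x" "0 < y" for x y
    using antipow_tangent[of "1 - \<alpha>" x y] that alpha by (simp add: q_eq)
  have xbar_powr: "xbar powr (- \<alpha>) * xbar = xbar powr (1 - \<alpha>)"
    using powr_mult_base[of xbar "- \<alpha>"] xbar by (simp add: mult.commute)

  have h0_deriv: "(h0 has_real_derivative \<phi> x) (at x)" if "0 < x" for x
  proof -
    have "(h0 has_real_derivative (\<rho> * x powr (1 - \<gamma> - 1) - x powr (2 - \<alpha> - \<gamma> - 1) / (1 - \<alpha>) +
        lam * x powr (2 - \<gamma> - 1)) / a) (at x)"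
      unfolding h0_def using a_pos alpha
      by (auto intro!: derivative_eq_intros antipow_deriv[OF that])
    moreover have "x powr (2 - \<alpha> - \<gamma> - 1) = x powr (1 - \<alpha>) * x powr (- \<gamma>)"
      "x powr (2 - \<gamma> - 1) = x * x powr (- \<gamma>)"
      using that powr_mult_base[of x "- \<gamma>"] powr_add[of x "1 - \<alpha>" "- \<gamma>"] by (auto simp: algebra_simps)
    ultimately show ?thesis
      by (simp add: \<phi>_def f_def algebra_simps)
  qed

  \<comment> \<open>The loss \<open>h0 x - h0 (b * x)\<close> is a positive multiple of
    \<open>\<rho>\<close> minus the concave function
    \<open>c1 * x powr (1 - \<alpha>) / (1 - \<alpha>) - lam * c2 * x\<close>. By stationarity the
    tangent at \<open>xbar\<close> shows that \<open>\<rho>\<close> is the maximum of that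
    function.\<close>
  have h0_impulse: "h0 (b * x) \<le> h0 x" if "0 < x" for x
  proof -
    have "c1 * (x powr (1 - \<alpha>) / (1 - \<alpha>)) \<le> c1 * (xbar powr (1 - \<alpha>) / (1 - \<alpha>) + xbar powr (- \<alpha>) * (x - xbar))"
      using tangent[OF that xbar] c_pos by (intro mult_left_mono) auto
    also have "\<dots> = c1 * (xbar powr (1 - \<alpha>) / (1 - \<alpha>)) + lam * c2 * (x - xbar)"
      using stationary by (simp add: distrib_left flip: mult.assoc)
    finally have "c1 * (x powr (1 - \<alpha>) / (1 - \<alpha>)) - lam * c2 * x \<le> \<rho>"
      by (simp add: \<rho>_def algebra_simps)
    then have "0 \<le> x powr (1 - \<gamma>) * gap b (1 - \<gamma>) * (\<rho> - (c1 * (x powr (1 - \<alpha>) / (1 - \<alpha>)) - lam * c2 * x)) / a"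
      using gaps[of "1 - \<gamma>"] a_pos by (intro divide_nonneg_pos mult_nonneg_nonneg) auto
    also have "\<dots> = h0 x - h0 (b * x)"
    proof -
      have "x powr (2 - \<alpha> - \<gamma>) = x powr (1 - \<gamma>) * x powr (1 - \<alpha>)"
        by (simp add: powr_add[symmetric] algebra_simps)
      moreover have "x powr (2 - \<gamma>) = x powr (1 - \<gamma>) * x"
        using powr_mult_base[of x "1 - \<gamma>"] that by (simp add: mult.commute)
      moreover have "gap b (2 - \<alpha> - \<gamma>) = gap b (1 - \<gamma>) * c1" "gap b (2 - \<gamma>) = gap b (1 - \<gamma>) * c2"
        using gaps[of "1 - \<gamma>"] by (auto simp: c1_def c2_def)
      moreover have "h0 x - h0 (b * x) = (\<rho> * (antipow (1 - \<gamma>) x - antipow (1 - \<gamma>) (b * x)) -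
          (antipow (2 - \<alpha> - \<gamma>) x - antipow (2 - \<alpha> - \<gamma>) (b * x)) / (1 - \<alpha>) +
          lam * (antipow (2 - \<gamma>) x - antipow (2 - \<gamma>) (b * x))) / a"
        by (simp add: h0_def algebra_simps diff_divide_distrib add_divide_distrib)
      then have "h0 x - h0 (b * x) = (\<rho> * (x powr (1 - \<gamma>) * gap b (1 - \<gamma>)) -
          (x powr (2 - \<alpha> - \<gamma>) * gap b (2 - \<alpha> - \<gamma>)) / (1 - \<alpha>) +
          lam * (x powr (2 - \<gamma>) * gap b (2 - \<gamma>))) / a"
        by (simp only: antipow_diff[OF b_pos that])
      ultimately show ?thesis
        by (simp add: algebra_simps)
    qed
    finally show ?thesis by simp
  qed

  \<comment> \<open>The first entry solves
    \<open>v powr (1 - \<alpha>) / (1 - \<alpha>) = \<rho>\<close>, because stationarity turns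
    \<open>\<rho>\<close> into
    \<open>\<alpha> * c1 * xbar powr (1 - \<alpha>) / (1 - \<alpha>)\<close>; below it
    \<open>f\<close> is at most \<open>\<rho>\<close>. The second is the maximizer of
    \<open>f\<close>; below it \<open>f\<close> increases.\<close>
  define y1 where "y1 = min (xbar * (\<alpha> * c1) powr (1 / (1 - \<alpha>))) (lam powr (- 1 / \<alpha>))"
  have y1: "0 < y1"
    using xbar alpha c_pos lam by (simp add: y1_def)
  have f_le: "f x \<le> \<rho>" if "0 < x" "x \<le> y1" for x
  proof -
    define v where "v = xbar * (\<alpha> * c1) powr (1 / (1 - \<alpha>))"
    have "x \<le> v" using that by (simp add: v_def y1_def)
    then have "antipow (1 - \<alpha>) x \<le> antipow (1 - \<alpha>) v"
      using antipow_less[of x v "1 - \<alpha>"] that by (cases "x = v") auto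
    also have "\<dots> = xbar powr (1 - \<alpha>) * (\<alpha> * c1) / (1 - \<alpha>)"
      using xbar alpha c_pos by (simp add: q_eq v_def powr_mult powr_powr)
    also have "\<dots> = \<rho>"
    proof -
      have "lam * (xbar * c2) = c1 * xbar powr (1 - \<alpha>)"
        using stationary xbar_powr by (simp add: mult.assoc mult.left_commute mult.commute flip: xbar_powr)
      with alpha show ?thesis
        by (simp add: \<rho>_def field_simps)
    qed
    finally have "x powr (1 - \<alpha>) / (1 - \<alpha>) \<le> \<rho>"
      by (simp add: q_eq)
    moreover have "0 \<le> lam * x"
      using lam that by simp
    ultimately show ?thesis
      by (simp add: f_def)
  qed
  have f_mono: "f x \<le> f z" if "0 < x" "x \<le> z" "z \<le> y1" for x z
  proof -
    have "lam = (lam powr (- 1 / \<alpha>)) powr (- \<alpha>)"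
      using lam alpha by (simp add: powr_powr)
    also have "\<dots> \<le> z powr (- \<alpha>)"
      using that alpha by (intro powr_mono2') (auto simp: y1_def)
    finally have "lam * (z - x) \<le> z powr (- \<alpha>) * (z - x)"
      using that by (intro mult_right_mono) auto
    with tangent[of x z] that show ?thesis
      by (simp add: f_def algebra_simps)
  qed
  have \<phi>_nonneg: "0 \<le> \<phi> x" if "0 < x" "x \<le> y1" for x
    using f_le[OF that] a_pos by (simp add: \<phi>_def)
  \<comment> \<open>Both factors \<open>\<rho> - f x\<close> and \<open>x powr (- \<gamma>)\<close>
    are nonnegative and nonincreasing up to \<open>y1\<close>.\<close>
  have \<phi>_antimono: "\<phi> z \<le> \<phi> x" if "0 < x" "x \<le> z" "z \<le> y1" for x z
    unfolding \<phi>_def using that f_mono[OF that] f_le[of x] f_le[of z] gamma a_pos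
    by (intro divide_right_mono mult_mono powr_mono2') auto
  have h0_mono: "h0 x \<le> h0 z" if "0 < x" "x \<le> z" "z \<le> y1" for x z
    using that h0_deriv \<phi>_nonneg
    by (intro DERIV_nonneg_imp_nondecreasing[of x z h0]) (metis order_less_le_trans order_trans)+

  \<comment> \<open>With the factor \<open>b\<close>, repeated impulses from any level at least
    \<open>y0\<close> cannot jump over the interval from \<open>y0\<close> to \<open>y1\<close>.
    They never raise \<open>h0\<close>, which is monotone on that interval, so \<open>h0 y0\<close>
    bounds \<open>h0\<close> from below on all levels from \<open>y0\<close> on.\<close>
  define y0 where "y0 = b * y1"
  have y0: "0 < y0" "y0 \<le> y1"
    using y1 b_pos b_less by (auto simp: y0_def mult_le_cancel_right1)
  have h0_iter: "h0 (b ^ m * x) \<le> h0 x" if "0 < x" for m x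
  proof (induction m)
    case (Suc m)
    have "h0 (b ^ Suc m * x) \<le> h0 (b ^ m * x)"
      using h0_impulse[of "b ^ m * x"] that b_pos by (simp add: mult.assoc)
    with Suc show ?case by linarith
  qed simp
  have h0_above: "h0 y0 \<le> h0 x" if "y0 \<le> x" for x
  proof -
    have x: "0 < x" using that y0 by simp
    define m where "m = (LEAST m. b ^ m * x < y1)"
    have less: "b ^ m * x < y1"
      unfolding m_def by (rule LEAST_impulses_less[OF y1])
    have "y0 \<le> b ^ m * x"
    proof (cases m)
      case (Suc k)
      then have "\<not> b ^ k * x < y1"
        using not_less_Least[of k "\<lambda>m. b ^ m * x < y1"] by (simp add: m_def)
      with Suc b_pos show ?thesis by (simp add: y0_def mult.assoc)
    qed (use that in simp)
    then have "h0 y0 \<le> h0 (b ^ m * x)"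
      using y0 less by (intro h0_mono) auto
    also have "\<dots> \<le> h0 x"
      by (rule h0_iter[OF x])
    finally show ?thesis .
  qed

  define h where "h x = (if x \<le> y0 then h0 y0 + \<phi> y0 * (x - y0) else h0 x)" for x
  define h' where "h' x = (if x \<le> y0 then \<phi> y0 else \<phi> x)" for x
  have h_deriv: "(h has_real_derivative h' x) (at x)" for x
    unfolding h_def h'_def using y0 h0_deriv by (intro DERIV_linear_extension) auto
  have h_impulse: "h (b * x) \<le> h x" if "0 < x" for x
  proof -
    have "b * x \<le> x" using that b_less by (simp add: mult_le_cancel_right1)
    have "0 \<le> \<phi> y0" by (rule \<phi>_nonneg[OF y0])
    consider "x \<le> y0" | "y0 < x" "b * x \<le> y0" | "y0 < b * x" by linarith
    then show ?thesis
    proof cases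
      case 1
      with \<open>b * x \<le> x\<close> \<open>0 \<le> \<phi> y0\<close> show ?thesis
        by (auto simp: h_def intro: mult_left_mono)
    next
      case 2
      then have "\<phi> y0 * (b * x - y0) \<le> 0"
        using \<open>0 \<le> \<phi> y0\<close> by (intro mult_nonneg_nonpos) auto
      with 2 h0_above[of x] show ?thesis
        by (simp add: h_def)
    next
      case 3
      with \<open>b * x \<le> x\<close> h0_impulse[OF that] show ?thesis
        by (simp add: h_def)
    qed
  qed
  have h_iter: "h (b ^ m * x) \<le> h x" if "0 < x" for m x
  proof (induction m)
    case (Suc m)
    have "h (b ^ Suc m * x) \<le> h (b ^ m * x)"
      using h_impulse[of "b ^ m * x"] that b_pos by (simp add: mult.assoc)
    with Suc show ?case by linarith
  qed simp
  \<comment> \<open>The bound is the value at 0 of the affine piece.\<close>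
  have h_lower: "h0 y0 - \<phi> y0 * y0 \<le> h x" if "0 < x" for x
  proof (cases "x \<le> y0")
    case True
    with \<phi>_nonneg[OF y0] that show ?thesis
      by (simp add: h_def algebra_simps)
  next
    case False
    with \<phi>_nonneg[OF y0] h0_above[of x] y0 show ?thesis
      by (auto simp: h_def intro: order_trans[rotated])
  qed
  have h'_le: "h' x * (a * x powr \<gamma>) \<le> \<rho> - f x" if "0 < x" for x
  proof -
    have "h' x \<le> \<phi> x"
      using \<phi>_antimono[OF that _ y0(2)] by (simp add: h'_def)
    then have "h' x * (a * x powr \<gamma>) \<le> \<phi> x * (a * x powr \<gamma>)"
      using a_pos by (intro mult_right_mono) auto
    also have "\<dots> = \<rho> - f x"
      using a_pos that by (simp add: \<phi>_def powr_minus)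
    finally show ?thesis .
  qed

  show ?thesis
  proof (intro exI ballI allI impI)
    fix T and \<tau> :: real assume T: "T \<in> policies" and tau: "0 < \<tau>"
    define x where "x = trajectory a \<gamma> b x0 T"
    have x: "traj x0 T x"
      unfolding x_def by (rule is_trajectory_trajectory[OF T x0])
    have x_pos: "0 < x t" if "0 \<le> t" for t
      using trajectory_pos[OF x that] .
    have int_powr: "(\<lambda>t. x t powr q) integrable_on {0..\<tau>}" for q
      using antipow_along_trajectory[OF T x, of \<tau> q] tau by (auto simp: integrable_on_def)
    have int_q: "(\<lambda>t. x t powr (1 - \<alpha>) / (1 - \<alpha>)) integrable_on {0..\<tau>}"
      using integrable_on_divide[OF int_powr] .
    have int_x: "x integrable_on {0..\<tau>}"
      by (rule integrable_eq[OF int_powr[of 1]]) (use x_pos in \<open>auto simp: less_imp_le\<close>)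
    have I: "((\<lambda>t. \<rho> - f (x t)) has_integral
        (\<rho> * \<tau> - (integral {0..\<tau>} (\<lambda>t. x t powr (1 - \<alpha>) / (1 - \<alpha>)) - lam * integral {0..\<tau>} x))) {0..\<tau>}"
      unfolding f_def using has_integral_const_real[of \<rho> 0 \<tau>] tau
      by (intro has_integral_diff has_integral_mult_right integrable_integral int_q int_x) (auto simp: mult.commute)
    have "((\<lambda>t. h' (x t) * (a * x t powr \<gamma>)) has_integral
        (h (x \<tau>) - h x0 + (\<Sum>s\<in>impulse_times T \<inter> {..<\<tau>}. h (x s) - h (b ^ impulses_at T s * x s)))) {0..\<tau>}"
      using tau by (intro integral_along_trajectory[OF T x] h_deriv) auto
    then have "h (x \<tau>) - h x0 + (\<Sum>s\<in>impulse_times T \<inter> {..<\<tau>}. h (x s) - h (b ^ impulses_at T s * x s)) \<le>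
        \<rho> * \<tau> - (integral {0..\<tau>} (\<lambda>t. x t powr (1 - \<alpha>) / (1 - \<alpha>)) - lam * integral {0..\<tau>} x)"
      by (rule has_integral_le[OF _ I]) (use h'_le x_pos in auto)
    moreover have "0 \<le> (\<Sum>s\<in>impulse_times T \<inter> {..<\<tau>}. h (x s) - h (b ^ impulses_at T s * x s))"
      using h_iter x_pos by (intro sum_nonneg) (auto simp: impulse_times_def)
    moreover have "h0 y0 - \<phi> y0 * y0 \<le> h (x \<tau>)"
      using h_lower x_pos tau by auto
    \<comment> \<open>The constant is \<open>h x0\<close> minus the lower bound of \<open>h\<close>,
      which involves neither \<open>T\<close> nor \<open>\<tau>\<close>.\<close>
    ultimately show "integral {0..\<tau>} (\<lambda>t. trajectory a \<gamma> b x0 T t powr (1 - \<alpha>) / (1 - \<alpha>)) \<le>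
        \<rho> * \<tau> + lam * integral {0..\<tau>} (trajectory a \<gamma> b x0 T) + (h x0 - (h0 y0 - \<phi> y0 * y0))"
      unfolding x_def[symmetric] by linarith
  qed
qed

section \<open>Mixtures and weak duality for a single user\<close>

lemma expectation_mixture:
  fixes g :: "(nat \<Rightarrow> ennreal) \<Rightarrow> real"
  assumes "0 \<le> \<beta>" "\<beta> \<le> 1"
  shows "measure_pmf.expectation (mixture \<beta> T S) g = \<beta> * g T + (1 - \<beta>) * g S"
  using assms by (simp add: mixture_def mult.commute)

text \<open>The constant \<open>C\<close> is common to both components of the mixture, so the bound
  for deterministic policies survives the expectation, and division by \<open>\<tau>\<close> removes
  \<open>C\<close> in the limit.\<close>

lemma J_obj_le_lagrangian:
  fixes \<alpha> lam xbar :: real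
  defines "c1 \<equiv> gap b (2 - \<alpha> - \<gamma>) / gap b (1 - \<gamma>)" and "c2 \<equiv> gap b (2 - \<gamma>) / gap b (1 - \<gamma>)"
  assumes "\<alpha> > 0" "\<alpha> \<noteq> 1" and lam: "lam > 0" and "xbar > 0" and "x0 > 0"
    and "c1 * xbar powr (- \<alpha>) = lam * c2"
    and u: "u \<in> mixed_policies"
  shows "J_obj \<alpha> a \<gamma> b x0 u \<le>
    ereal (xbar powr (1 - \<alpha>) / (1 - \<alpha>) * c1 - lam * (xbar * c2)) + ereal lam * G_obj a \<gamma> b x0 u"
proof -
  define \<rho> where "\<rho> = xbar powr (1 - \<alpha>) / (1 - \<alpha>) * c1 - lam * (xbar * c2)"
  define Q where "Q \<tau> T = integral {0..\<tau>} (\<lambda>t. trajectory a \<gamma> b x0 T t powr (1 - \<alpha>) / (1 - \<alpha>))" for \<tau> T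
  define X where "X \<tau> T = integral {0..\<tau>} (trajectory a \<gamma> b x0 T)" for \<tau> T
  obtain C where C: "\<And>T \<tau>. T \<in> policies \<Longrightarrow> \<tau> > 0 \<Longrightarrow> Q \<tau> T \<le> \<rho> * \<tau> + lam * X \<tau> T + C"
    using lagrangian_bound[of \<alpha> lam xbar x0] assms unfolding Q_def X_def \<rho>_def by blast
  obtain \<beta> T S where mix: "u = mixture \<beta> T S" "0 \<le> \<beta>" "\<beta> \<le> 1" "T \<in> policies" "S \<in> policies"
    using u by (auto simp: mixed_policies_def)
  \<comment> \<open>Absorbing \<open>C / \<tau>\<close> into a constant \<open>e\<close> beforehand
    leaves only a constant summand and a constant factor to be moved out of the upper limit.\<close>
  have "J_obj \<alpha> a \<gamma> b x0 u \<le> ereal \<rho> + ereal lam * G_obj a \<gamma> b x0 u + ereal e" if e: "e > 0" for e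
  proof -
    have bound: "1 / \<tau> * measure_pmf.expectation u (Q \<tau>) \<le> (\<rho> + e) + lam * (1 / \<tau> * measure_pmf.expectation u (X \<tau>))"
      if tau: "\<tau> > 0" and Ce: "C / \<tau> < e" for \<tau>
    proof -
      have "measure_pmf.expectation u (Q \<tau>) = \<beta> * Q \<tau> T + (1 - \<beta>) * Q \<tau> S"
        using mix by (simp add: expectation_mixture)
      also have "\<dots> \<le> \<beta> * (\<rho> * \<tau> + lam * X \<tau> T + C) + (1 - \<beta>) * (\<rho> * \<tau> + lam * X \<tau> S + C)"
        using mix C tau by (intro add_mono mult_left_mono) auto
      also have "\<dots> = \<rho> * \<tau> + lam * measure_pmf.expectation u (X \<tau>) + C"
        using mix by (simp add: expectation_mixture algebra_simps)
      finally have "1 / \<tau> * measure_pmf.expectation u (Q \<tau>) \<le>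
          1 / \<tau> * (\<rho> * \<tau> + lam * measure_pmf.expectation u (X \<tau>) + C)"
        using tau by (intro mult_left_mono) auto
      also have "\<dots> = \<rho> + lam * (1 / \<tau> * measure_pmf.expectation u (X \<tau>)) + C / \<tau>"
        using tau by (simp add: add_divide_distrib)
      finally show ?thesis
        using Ce by linarith
    qed
    have "((\<lambda>\<tau>::real. C / \<tau>) \<longlongrightarrow> 0) at_top"
      by real_asymp
    then have "\<forall>\<^sub>F \<tau> in at_top. C / \<tau> < e"
      by (rule order_tendstoD) (rule e)
    then have ev: "\<forall>\<^sub>F \<tau> in at_top. ereal (1 / \<tau> * measure_pmf.expectation u (Q \<tau>)) \<le>
        ereal (\<rho> + e) + ereal lam * ereal (1 / \<tau> * measure_pmf.expectation u (X \<tau>))"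
      using eventually_gt_at_top[of "0::real"] by eventually_elim (use bound in simp)
    \<comment> \<open>The lower limit in \<open>J_obj\<close> is first enlarged to an upper limit,
      to match the one in \<open>G_obj\<close>.\<close>
    have "J_obj \<alpha> a \<gamma> b x0 u \<le> Limsup at_top (\<lambda>\<tau>. ereal (1 / \<tau> * measure_pmf.expectation u (Q \<tau>)))"
      unfolding J_obj_def Q_def by (rule Liminf_le_Limsup) simp
    also have "\<dots> \<le> Limsup at_top (\<lambda>\<tau>. ereal (\<rho> + e) + ereal lam * ereal (1 / \<tau> * measure_pmf.expectation u (X \<tau>)))"
      by (rule Limsup_mono[OF ev])
    also have "\<dots> = ereal (\<rho> + e) + ereal lam * G_obj a \<gamma> b x0 u"
      unfolding G_obj_def X_def using lam
      by (subst Limsup_add_ereal_left) (auto simp: Limsup_ereal_mult_left simp del: times_ereal.simps)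
    also have "\<dots> = ereal \<rho> + ereal lam * G_obj a \<gamma> b x0 u + ereal e"
      by (metis plus_ereal.simps(1) add.assoc add.commute)
    finally show ?thesis .
  qed
  then have "J_obj \<alpha> a \<gamma> b x0 u \<le> ereal \<rho> + ereal lam * G_obj a \<gamma> b x0 u"
    by (rule ereal_le_epsilon2)
  then show ?thesis
    by (simp only: \<rho>_def)
qed

text \<open>With nonnegative summands, a feasible policy has a real \<open>G_obj\<close> for every
  single user, so the Lagrangian bounds can be added in real arithmetic.\<close>

lemma G_obj_nonneg:
  assumes "x0 > 0" and u: "u \<in> mixed_policies"
  shows "0 \<le> G_obj a \<gamma> b x0 u"
proof -
  obtain \<beta> T S where mix: "u = mixture \<beta> T S" "0 \<le> \<beta>" "\<beta> \<le> 1" "T \<in> policies" "S \<in> policies"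
    using u by (auto simp: mixed_policies_def)
  have nonneg: "0 \<le> integral {0..\<tau>} (trajectory a \<gamma> b x0 T)" if T: "T \<in> policies" for T and \<tau> :: real
  proof -
    have x: "traj x0 T (trajectory a \<gamma> b x0 T)"
      by (rule is_trajectory_trajectory[OF T assms(1)])
    show ?thesis
      by (cases "trajectory a \<gamma> b x0 T integrable_on {0..\<tau>}")
        (auto intro!: integral_nonneg less_imp_le[OF trajectory_pos[OF x]] simp: not_integrable_integral)
  qed
  have "Limsup at_top (\<lambda>_::real. 0) \<le> G_obj a \<gamma> b x0 u"
    unfolding G_obj_def mix(1) using mix(2-) nonneg
    by (intro Limsup_mono eventually_mono[OF eventually_gt_at_top[of 0]])
      (auto simp: expectation_mixture intro!: divide_nonneg_pos)
  then show ?thesis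
    by (simp add: Limsup_const)
qed

end

section \<open>Optimality\<close>

text \<open>The average resource use of the threshold policy is
  \<open>share \<alpha> \<gamma> b * lam powr (- 1 / \<alpha>)\<close>. Because the multiplier
  splits off as a factor, the budget equation can be solved in closed form.\<close>

definition share :: "real \<Rightarrow> real \<Rightarrow> real \<Rightarrow> real" where
  "share \<alpha> \<gamma> b = gap b (2 - \<gamma>) / gap b (1 - \<gamma>) * (gap b (2 - \<alpha> - \<gamma>) / gap b (2 - \<gamma>)) powr (1 / \<alpha>)"

context user
begin

section \<open>Thresholds and resource use as functions of the multiplier\<close>

lemma threshold_eq:
  assumes "2 - \<alpha> - \<gamma> \<noteq> 0" "lam > 0"
  shows "threshold \<alpha> \<gamma> b lam = (gap b (2 - \<alpha> - \<gamma>) / gap b (2 - \<gamma>)) powr (1 / \<alpha>) * lam powr (- 1 / \<alpha>)"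
proof -
  have "threshold \<alpha> \<gamma> b lam = (gap b (2 - \<alpha> - \<gamma>) / gap b (2 - \<gamma>) / lam) powr (1 / \<alpha>)"
    using assms gamma by (simp add: threshold_def gap_eq mult.commute mult.left_commute)
  also have "\<dots> = (gap b (2 - \<alpha> - \<gamma>) / gap b (2 - \<gamma>)) powr (1 / \<alpha>) / lam powr (1 / \<alpha>)"
    by (rule powr_divide)
  also have "\<dots> = (gap b (2 - \<alpha> - \<gamma>) / gap b (2 - \<gamma>)) powr (1 / \<alpha>) * lam powr (- 1 / \<alpha>)"
    by (simp add: powr_minus_divide)
  finally show ?thesis .
qed

lemma threshold_pos:
  assumes "2 - \<alpha> - \<gamma> \<noteq> 0" "lam > 0"
  shows "threshold \<alpha> \<gamma> b lam > 0"
  using threshold_eq[OF assms] assms gaps_pos[of "2 - \<gamma>"] gaps_pos[of "2 - \<alpha> - \<gamma>"] by simp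

lemma threshold_share:
  assumes "2 - \<alpha> - \<gamma> \<noteq> 0" "lam > 0"
  shows "threshold \<alpha> \<gamma> b lam * (gap b (2 - \<gamma>) / gap b (1 - \<gamma>)) = share \<alpha> \<gamma> b * lam powr (- 1 / \<alpha>)"
  by (simp add: threshold_eq[OF assms] share_def)

text \<open>The first-order condition \<open>c1 * x powr (- \<alpha>) = lam * c2\<close> for the
  concave Lagrangian average; it ties the given formula for the threshold to
  \<open>lagrangian_bound\<close>.\<close>

lemma threshold_stationary:
  assumes "2 - \<alpha> - \<gamma> \<noteq> 0" "lam > 0" "\<alpha> > 0"
  shows "gap b (2 - \<alpha> - \<gamma>) / gap b (1 - \<gamma>) * threshold \<alpha> \<gamma> b lam powr (- \<alpha>) =
    lam * (gap b (2 - \<gamma>) / gap b (1 - \<gamma>))"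
proof -
  have "threshold \<alpha> \<gamma> b lam powr (- \<alpha>) = lam * gap b (2 - \<gamma>) / gap b (2 - \<alpha> - \<gamma>)"
    using assms gaps_pos[of "2 - \<gamma>"] gaps_pos[of "2 - \<alpha> - \<gamma>"]
    by (simp add: threshold_eq powr_mult powr_divide powr_powr powr_minus_divide)
  then show ?thesis
    using gaps_pos[of "2 - \<alpha> - \<gamma>"] by simp
qed

lemma share_pos: "share \<alpha> \<gamma> b > 0"
  using gaps_pos[of "2 - \<gamma>"] gaps_pos[of "2 - \<alpha> - \<gamma>"] gaps_pos[of "1 - \<gamma>"] by (simp add: share_def)

text \<open>For \<open>\<gamma> = 1\<close> two shapes occur: this one in the homogeneous formula,
  and that of \<open>share_eq_1'\<close> as a summand of \<open>lambda_star\<close>.\<close>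

lemma share_eq_1:
  assumes "\<gamma> = 1" "\<alpha> > 0" "\<alpha> \<noteq> 1"
  shows "share \<alpha> \<gamma> b = ((1 - b powr (1 - \<alpha>)) / ((1 - b) * (1 - \<alpha>))) powr (1 / \<alpha>) * ((b - 1) / ln b)"
proof -
  have "(1 - b) / (- ln b) = (b - 1) / ln b"
    using minus_divide_divide[of "b - 1" "ln b"] by simp
  moreover have "share \<alpha> \<gamma> b = (1 - b) / (- ln b) * ((1 - b powr (1 - \<alpha>)) / (1 - \<alpha>) / (1 - b)) powr (1 / \<alpha>)"
    using assms b_pos by (simp add: share_def gap_eq)
  ultimately show ?thesis
    by (simp add: mult.commute)
qed

lemma share_eq_1':
  assumes "\<gamma> = 1" "\<alpha> > 0" "\<alpha> \<noteq> 1"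
  shows "share \<alpha> \<gamma> b = ((1 - b powr (1 - \<alpha>)) / (1 - \<alpha>)) powr (1 / \<alpha>) *
    ((1 - b) powr ((\<alpha> - 1) / \<alpha>) / (- ln b))"
proof -
  define D where "D = (1 - b powr (1 - \<alpha>)) / (1 - \<alpha>)"
  have "D > 0"
    using gaps_pos[of "1 - \<alpha>"] assms by (simp add: gap_eq D_def)
  have "share \<alpha> \<gamma> b = (1 - b) / (- ln b) * (D / (1 - b)) powr (1 / \<alpha>)"
    using assms b_pos by (simp add: share_def gap_eq D_def)
  also have "\<dots> = (1 - b) / (- ln b) * (D powr (1 / \<alpha>) / (1 - b) powr (1 / \<alpha>))"
    using \<open>D > 0\<close> b_less by (simp add: powr_divide)
  also have "\<dots> = D powr (1 / \<alpha>) * ((1 - b) powr (1 - 1 / \<alpha>) / (- ln b))"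
    using b_less by (simp add: powr_diff mult.commute)
  also have "1 - 1 / \<alpha> = (\<alpha> - 1) / \<alpha>"
    using assms by (simp add: field_simps)
  finally show ?thesis
    by (simp add: D_def)
qed

lemma share_neq_1:
  assumes "\<gamma> \<noteq> 1" "\<alpha> > 0" "2 - \<alpha> - \<gamma> \<noteq> 0"
  shows "share \<alpha> \<gamma> b = (1 - \<gamma>) / (2 - \<gamma>) *
    ((1 - b powr (2 - \<gamma>)) / (1 - b powr (1 - \<gamma>))) *
    ((2 - \<gamma>) / (1 - b powr (2 - \<gamma>))) powr (1 / \<alpha>) *
    ((1 - b powr (2 - \<alpha> - \<gamma>)) / (2 - \<alpha> - \<gamma>)) powr (1 / \<alpha>)"
proof -
  have gap: "gap b (2 - \<gamma>) = (1 - b powr (2 - \<gamma>)) / (2 - \<gamma>)"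
    "gap b (1 - \<gamma>) = (1 - b powr (1 - \<gamma>)) / (1 - \<gamma>)"
    "gap b (2 - \<alpha> - \<gamma>) = (1 - b powr (2 - \<alpha> - \<gamma>)) / (2 - \<alpha> - \<gamma>)"
    using assms gamma by (auto simp: gap_eq)
  have "(1 / gap b (2 - \<gamma>)) powr (1 / \<alpha>) * gap b (2 - \<alpha> - \<gamma>) powr (1 / \<alpha>) =
      (gap b (2 - \<alpha> - \<gamma>) / gap b (2 - \<gamma>)) powr (1 / \<alpha>)"
    using gaps_pos by (subst powr_mult[symmetric]) (auto simp: less_imp_le)
  moreover have "1 / gap b (2 - \<gamma>) = (2 - \<gamma>) / (1 - b powr (2 - \<gamma>))"
    by (simp add: gap)
  moreover have "gap b (2 - \<gamma>) / gap b (1 - \<gamma>) = (1 - \<gamma>) / (2 - \<gamma>) *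
      ((1 - b powr (2 - \<gamma>)) / (1 - b powr (1 - \<gamma>)))"
    by (simp add: gap)
  ultimately show ?thesis
    unfolding share_def by (simp only: gap(3) mult.assoc)
qed

lemma
  assumes "2 - \<alpha> - \<gamma> \<noteq> 0" "lam > 0" "x0 > 0"
  shows G_star_eq: "G_star \<alpha> a \<gamma> b x0 lam = ereal (share \<alpha> \<gamma> b * lam powr (- 1 / \<alpha>))"
    and J_star_eq: "J_star \<alpha> a \<gamma> b x0 lam = ereal (threshold \<alpha> \<gamma> b lam powr (1 - \<alpha>) / (1 - \<alpha>) *
      (gap b (2 - \<alpha> - \<gamma>) / gap b (1 - \<gamma>)))"
  using G_obj_threshold_policy[OF assms(3) threshold_pos[OF assms(1,2)]]
    J_obj_threshold_policy[OF assms(3) threshold_pos[OF assms(1,2)]]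
  by (simp_all only: G_star_def J_star_def threshold_share[OF assms(1,2)])

text \<open>The multiplier as a price: using \<open>g\<close> instead of the resource of the
  threshold policy gains at most \<open>lam\<close> per unit of the difference. The constant in the
  Lagrangian bound is the value of the threshold policy minus the price of its own use.\<close>

lemma J_obj_le_J_star:
  assumes "2 - \<alpha> - \<gamma> \<noteq> 0" "lam > 0" "x0 > 0" "\<alpha> > 0" "\<alpha> \<noteq> 1" "u \<in> mixed_policies"
    and "G_obj a \<gamma> b x0 u = ereal g"
  shows "J_obj \<alpha> a \<gamma> b x0 u \<le> J_star \<alpha> a \<gamma> b x0 lam + ereal (lam * (g - share \<alpha> \<gamma> b * lam powr (- 1 / \<alpha>)))"
proof -
  have "J_obj \<alpha> a \<gamma> b x0 u \<le> ereal (threshold \<alpha> \<gamma> b lam powr (1 - \<alpha>) / (1 - \<alpha>) *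
      (gap b (2 - \<alpha> - \<gamma>) / gap b (1 - \<gamma>)) -
      lam * (threshold \<alpha> \<gamma> b lam * (gap b (2 - \<gamma>) / gap b (1 - \<gamma>)))) + ereal lam * G_obj a \<gamma> b x0 u"
    by (rule J_obj_le_lagrangian[OF assms(4,5,2) threshold_pos[OF assms(1,2)] assms(3)
          threshold_stationary[OF assms(1,2,4)] assms(6)])
  also have "\<dots> = J_star \<alpha> a \<gamma> b x0 lam + ereal (lam * (g - share \<alpha> \<gamma> b * lam powr (- 1 / \<alpha>)))"
    unfolding J_star_eq[OF assms(1-3)] threshold_share[OF assms(1,2)] assms(7)
    by (simp add: right_diff_distrib)
  finally show ?thesis .
qed

end

text \<open>The right-hand side is the solution \<open>lam\<close> of the budget equation: the sum
  of the shares times \<open>lam powr (- 1 / \<alpha>)\<close> equals \<open>c\<close>.\<close>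

lemma lambda_star_eq:
  fixes \<gamma> b :: "'n::finite \<Rightarrow> real"
  assumes "c > 0" "\<alpha> > 0" "\<alpha> \<noteq> 1"
    and "\<And>k. 0 \<le> \<gamma> k \<and> \<gamma> k \<le> 1" "\<And>k. 0 < b k \<and> b k < 1" "\<And>k. 2 - \<alpha> - \<gamma> k \<noteq> 0"
  shows "lambda_star c \<alpha> \<gamma> b = ((\<Sum>k\<in>UNIV. share \<alpha> (\<gamma> k) (b k)) / c) powr \<alpha>"
proof -
  \<comment> \<open>The speed 1 is a placeholder, as neither \<open>share\<close> nor
    \<open>lambda_star\<close> contains \<open>a\<close>.\<close>
  have user: "user 1 (\<gamma> k) (b k)" for k
    using assms by unfold_locales auto
  let ?s = "\<lambda>k. share \<alpha> (\<gamma> k) (b k)"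
  have "(\<Sum>k\<in>UNIV. ?s k) = sum ?s ({k. \<gamma> k \<noteq> 1} \<union> {k. \<gamma> k = 1})"
    by (intro arg_cong[where f = "sum ?s"]) auto
  also have "\<dots> = sum ?s {k. \<gamma> k \<noteq> 1} + sum ?s {k. \<gamma> k = 1}"
    by (intro sum.union_disjoint) auto
  finally have split: "(\<Sum>k\<in>UNIV. ?s k) = sum ?s {k. \<gamma> k \<noteq> 1} + sum ?s {k. \<gamma> k = 1}" .
  have "lambda_star c \<alpha> \<gamma> b = 1 / c powr \<alpha> * (sum ?s {k. \<gamma> k \<noteq> 1} + sum ?s {k. \<gamma> k = 1}) powr \<alpha>"
    unfolding lambda_star_def
    by (intro arg_cong[where f = "\<lambda>t. 1 / c powr \<alpha> * t powr \<alpha>"] arg_cong2[where f = "(+)"] sum.cong refl)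
      (use user.share_neq_1[OF user] user.share_eq_1'[OF user] assms in auto)
  also have "\<dots> = ((\<Sum>k\<in>UNIV. ?s k) / c) powr \<alpha>"
    by (simp only: split powr_divide times_divide_eq_left mult_1_left)
  finally show ?thesis .
qed

lemma convex_performance_space: "convex (performance_space \<alpha> a \<gamma> b x0)"
  unfolding performance_space_def user_space_def
  by (auto intro!: convexI convexD[OF convex_convex_hull])

theorem theorem1:
  fixes c \<alpha> :: real
    and a \<gamma> b x0 :: "'n::finite \<Rightarrow> real"
  assumes "c > 0" and "\<alpha> > 0" and "\<alpha> \<noteq> 1"
    and "\<And>k. a k > 0"
    and "\<And>k. 0 \<le> \<gamma> k \<and> \<gamma> k \<le> 1"
    and "\<And>k. 0 < b k \<and> b k < 1"
    and "\<And>k. 2 - \<alpha> - \<gamma> k \<noteq> 0"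
    and "\<And>k. x0 k > 0"
  shows
    "let \<Omega> = performance_space \<alpha> a \<gamma> b x0; lams = lambda_star c \<alpha> \<gamma> b in
     (convex \<Omega> \<and>
      convex_on \<Omega> (\<lambda>\<omega>. - J_tilde \<omega>) \<and>
      convex_on \<Omega> G_tilde \<and>
      (\<forall>k. \<forall>lam>0. \<bar>J_star \<alpha> (a k) (\<gamma> k) (b k) (x0 k) lam\<bar> \<noteq> \<infinity> \<and>
                 \<bar>G_star \<alpha> (a k) (\<gamma> k) (b k) (x0 k) lam\<bar> \<noteq> \<infinity>)) \<and>
     (\<exists>\<omega>\<in>\<Omega>. G_tilde \<omega> < c) \<and>
     ((let T = (\<lambda>k. threshold_policy (a k) (\<gamma> k) (b k) (x0 k) (threshold \<alpha> (\<gamma> k) (b k) lams)) in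
        (\<forall>k. T k \<in> policies) \<and>
        optimal_for
          (\<lambda>u. \<Sum>k\<in>UNIV. J_obj \<alpha> (a k) (\<gamma> k) (b k) (x0 k) (u k))
          (\<lambda>u. \<Sum>k\<in>UNIV. G_obj (a k) (\<gamma> k) (b k) (x0 k) (u k))
          c {u. \<forall>k. u k \<in> mixed_policies} (\<lambda>k. return_pmf (T k))) \<and>
      (\<forall>g \<beta>. (\<forall>k. \<gamma> k = g \<and> b k = \<beta>) \<longrightarrow>
        (g \<noteq> 1 \<longrightarrow>
          lams = real CARD('n) powr \<alpha> / c powr \<alpha> *
               ((1 - g) powr \<alpha> / (1 - \<beta> powr (1 - g)) powr \<alpha>) *
               ((1 - \<beta> powr (2 - g)) powr \<alpha> / (2 - g) powr \<alpha>) *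
               ((2 - g) / (1 - \<beta> powr (2 - g))) *
               ((1 - \<beta> powr (2 - \<alpha> - g)) / (2 - \<alpha> - g)) \<and>
          (\<forall>k. threshold \<alpha> (\<gamma> k) (b k) lams =
               c / real CARD('n) * ((1 - \<beta> powr (1 - g)) / (1 - g)) *
               ((2 - g) / (1 - \<beta> powr (2 - g))))) \<and>
        (g = 1 \<longrightarrow>
          lams = 1 / c powr \<alpha> *
               (real CARD('n) *
                (((1 - \<beta> powr (1 - \<alpha>)) / ((1 - \<beta>) * (1 - \<alpha>))) powr (1 / \<alpha>) *
                 ((\<beta> - 1) / ln \<beta>))) powr \<alpha>)))"
proof -
  define lams where "lams = lambda_star c \<alpha> \<gamma> b"
  define S where "S = (\<Sum>k\<in>UNIV. share \<alpha> (\<gamma> k) (b k))"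
  have user: "user (a k) (\<gamma> k) (b k)" for k
    using assms by unfold_locales auto
  note q = assms(7) and x0 = assms(8)
  have S: "S > 0"
    unfolding S_def by (intro sum_pos user.share_pos[OF user]) auto
  have lams_eq: "lams = (S / c) powr \<alpha>"
    unfolding lams_def S_def by (intro lambda_star_eq assms)
  then have lams: "lams > 0"
    using S assms(1) by simp
  have powr_inv: "((s / c) powr \<alpha>) powr (- 1 / \<alpha>) = c / s" if "s > 0" for s
    using that assms(1,2) by (simp add: powr_powr powr_minus_divide)
  define \<Omega> where "\<Omega> = performance_space \<alpha> a \<gamma> b x0"
  have \<Omega>: "convex \<Omega>"
    unfolding \<Omega>_def by (rule convex_performance_space)
  have convex_on: "convex_on \<Omega> (\<lambda>\<omega>. - J_tilde \<omega>)" "convex_on \<Omega> G_tilde"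
    using \<Omega> by (auto simp: convex_on_def J_tilde_def G_tilde_def sum.distrib sum_distrib_left)
  have finite: "\<forall>k. \<forall>lam>0. \<bar>J_star \<alpha> (a k) (\<gamma> k) (b k) (x0 k) lam\<bar> \<noteq> \<infinity> \<and>
      \<bar>G_star \<alpha> (a k) (\<gamma> k) (b k) (x0 k) lam\<bar> \<noteq> \<infinity>"
    by (simp add: user.G_star_eq[OF user q _ x0] user.J_star_eq[OF user q _ x0])
  have slater: "\<exists>\<omega>\<in>\<Omega>. G_tilde \<omega> < c"
  proof
    \<comment> \<open>Multiplier for the budget \<open>c / 2\<close>: the threshold policies then
      use exactly half of \<open>c\<close>.\<close>
    define lam where "lam = (2 * S / c) powr \<alpha>"
    have lam: "lam > 0"
      using S assms(1) by (simp add: lam_def)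
    define \<omega> :: "(real \<times> real) ^ 'n" where "\<omega> = (\<chi> k.
      (- real_of_ereal (J_star \<alpha> (a k) (\<gamma> k) (b k) (x0 k) lam), real_of_ereal (G_star \<alpha> (a k) (\<gamma> k) (b k) (x0 k) lam)))"
    show "\<omega> \<in> \<Omega>"
      unfolding \<Omega>_def performance_space_def user_space_def \<omega>_def
      using lam by (auto intro!: hull_inc)
    have "G_tilde \<omega> = (\<Sum>k\<in>UNIV. share \<alpha> (\<gamma> k) (b k) * lam powr (- 1 / \<alpha>))"
      by (simp add: G_tilde_def \<omega>_def user.G_star_eq[OF user q lam x0])
    also have "\<dots> = S * lam powr (- 1 / \<alpha>)"
      by (simp add: S_def sum_distrib_right)
    also have "lam powr (- 1 / \<alpha>) = c / (2 * S)"
      unfolding lam_def using S by (intro powr_inv) simp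
    also have "S * (c / (2 * S)) = c / 2"
      using S by simp
    also have "\<dots> < c"
      using assms(1) by simp
    finally show "G_tilde \<omega> < c" .
  qed
  define T where "T k = threshold_policy (a k) (\<gamma> k) (b k) (x0 k) (threshold \<alpha> (\<gamma> k) (b k) lams)" for k
  have T: "\<forall>k. T k \<in> policies"
    unfolding T_def
    by (rule allI, rule user.threshold_policy_in_policies[OF user x0 user.threshold_pos[OF user q lams]])
  have total: "(\<Sum>k\<in>UNIV. share \<alpha> (\<gamma> k) (b k) * lams powr (- 1 / \<alpha>)) = c"
  proof -
    have "(\<Sum>k\<in>UNIV. share \<alpha> (\<gamma> k) (b k) * lams powr (- 1 / \<alpha>)) = S * lams powr (- 1 / \<alpha>)"
      by (simp add: S_def sum_distrib_right)
    moreover have "lams powr (- 1 / \<alpha>) = c / S"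
      unfolding lams_eq by (rule powr_inv[OF S])
    ultimately show ?thesis
      using S by (simp only:) simp
  qed
  have optimal: "optimal_for
      (\<lambda>u. \<Sum>k\<in>UNIV. J_obj \<alpha> (a k) (\<gamma> k) (b k) (x0 k) (u k))
      (\<lambda>u. \<Sum>k\<in>UNIV. G_obj (a k) (\<gamma> k) (b k) (x0 k) (u k))
      c {u. \<forall>k. u k \<in> mixed_policies} (\<lambda>k. return_pmf (T k))"
    unfolding optimal_for_def
  proof (intro conjI ballI impI)
    have "return_pmf (T k) = mixture 1 (T k) (T k)" for k
      by (simp add: mixture_def)
    then show "(\<lambda>k. return_pmf (T k)) \<in> {u. \<forall>k. u k \<in> mixed_policies}"
      using T by (force simp: mixed_policies_def)
    have "(\<Sum>k\<in>UNIV. G_star \<alpha> (a k) (\<gamma> k) (b k) (x0 k) lams) = ereal c"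
      by (simp only: user.G_star_eq[OF user q lams x0] sum_ereal total)
    then show "(\<Sum>k\<in>UNIV. G_obj (a k) (\<gamma> k) (b k) (x0 k) (return_pmf (T k))) \<le> ereal c"
      by (simp add: G_star_def T_def)
  next
    fix v assume v: "v \<in> {u. \<forall>k. u k \<in> mixed_policies}"
      and G: "(\<Sum>k\<in>UNIV. G_obj (a k) (\<gamma> k) (b k) (x0 k) (v k)) \<le> ereal c"
    have nonneg: "0 \<le> G_obj (a k) (\<gamma> k) (b k) (x0 k) (v k)" for k
      using user.G_obj_nonneg[OF user x0] v by blast
    have "\<exists>g. G_obj (a k) (\<gamma> k) (b k) (x0 k) (v k) = ereal g" for k
    proof -
      have "G_obj (a k) (\<gamma> k) (b k) (x0 k) (v k) \<le> (\<Sum>k\<in>UNIV. G_obj (a k) (\<gamma> k) (b k) (x0 k) (v k))"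
        using sum_mono2[of UNIV "{k}" "\<lambda>k. G_obj (a k) (\<gamma> k) (b k) (x0 k) (v k)"] nonneg by simp
      with G nonneg[of k] show ?thesis
        by (cases "G_obj (a k) (\<gamma> k) (b k) (x0 k) (v k)") auto
    qed
    then obtain g where g: "\<And>k. G_obj (a k) (\<gamma> k) (b k) (x0 k) (v k) = ereal (g k)"
      by metis
    define s where "s k = share \<alpha> (\<gamma> k) (b k) * lams powr (- 1 / \<alpha>)" for k
    \<comment> \<open>Weak duality, summed over the users. The gain over the threshold policies is
      at most \<open>lams\<close> times total use minus \<open>c\<close>, which feasibility makes
      nonpositive.\<close>
    have "(\<Sum>k\<in>UNIV. J_obj \<alpha> (a k) (\<gamma> k) (b k) (x0 k) (v k)) \<le>
        (\<Sum>k\<in>UNIV. J_star \<alpha> (a k) (\<gamma> k) (b k) (x0 k) lams + ereal (lams * (g k - s k)))"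
      unfolding s_def using v
      by (intro sum_mono user.J_obj_le_J_star[OF user q lams x0 assms(2,3) _ g]) auto
    also have "\<dots> = (\<Sum>k\<in>UNIV. J_star \<alpha> (a k) (\<gamma> k) (b k) (x0 k) lams) + ereal (lams * (sum g UNIV - sum s UNIV))"
      by (simp add: sum.distrib sum_subtractf flip: sum_distrib_left)
    also have "\<dots> \<le> (\<Sum>k\<in>UNIV. J_star \<alpha> (a k) (\<gamma> k) (b k) (x0 k) lams) + ereal 0"
    proof (intro add_left_mono)
      have "sum g UNIV \<le> c"
        using G by (simp only: g sum_ereal ereal_less_eq)
      moreover have "sum s UNIV = c"
        using total unfolding s_def[symmetric] .
      ultimately show "ereal (lams * (sum g UNIV - sum s UNIV)) \<le> ereal 0"
        using lams by (simp add: mult_le_0_iff)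
    qed
    finally show "(\<Sum>k\<in>UNIV. J_obj \<alpha> (a k) (\<gamma> k) (b k) (x0 k) (v k)) \<le>
        (\<Sum>k\<in>UNIV. J_obj \<alpha> (a k) (\<gamma> k) (b k) (x0 k) (return_pmf (T k)))"
      by (simp add: J_star_def T_def zero_ereal_def[symmetric])
  qed
  have homogeneous: "\<forall>g \<beta>. (\<forall>k. \<gamma> k = g \<and> b k = \<beta>) \<longrightarrow>
        (g \<noteq> 1 \<longrightarrow>
          lams = real CARD('n) powr \<alpha> / c powr \<alpha> *
               ((1 - g) powr \<alpha> / (1 - \<beta> powr (1 - g)) powr \<alpha>) *
               ((1 - \<beta> powr (2 - g)) powr \<alpha> / (2 - g) powr \<alpha>) *
               ((2 - g) / (1 - \<beta> powr (2 - g))) *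
               ((1 - \<beta> powr (2 - \<alpha> - g)) / (2 - \<alpha> - g)) \<and>
          (\<forall>k. threshold \<alpha> (\<gamma> k) (b k) lams =
               c / real CARD('n) * ((1 - \<beta> powr (1 - g)) / (1 - g)) *
               ((2 - g) / (1 - \<beta> powr (2 - g))))) \<and>
        (g = 1 \<longrightarrow>
          lams = 1 / c powr \<alpha> *
               (real CARD('n) *
                (((1 - \<beta> powr (1 - \<alpha>)) / ((1 - \<beta>) * (1 - \<alpha>))) powr (1 / \<alpha>) *
                 ((\<beta> - 1) / ln \<beta>))) powr \<alpha>)"
  proof (intro conjI impI allI)
    fix g \<beta> assume hom: "\<forall>k. \<gamma> k = g \<and> b k = \<beta>"
    let ?N = "real CARD('n)"
    \<comment> \<open>Any user carries the common parameters; \<open>undefined\<close> serves as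
      one, and 1 again stands for the speed.\<close>
    have u: "user 1 g \<beta>" and q_g: "2 - \<alpha> - g \<noteq> 0" and g_le: "g \<le> 1" and \<beta>: "0 < \<beta>" "\<beta> < 1"
      using assms(5,6,7)[of undefined] hom by (auto intro!: user.intro)
    have S_hom: "S = ?N * share \<alpha> g \<beta>"
      using hom by (simp add: S_def)
    note gaps = user.gaps_pos[OF u]
    {
      assume "g \<noteq> 1"
      then have g: "g < 1" using g_le by simp
      have powr_less: "\<beta> powr r < 1" if "r > 0" for r
        using powr_less_mono2[of r \<beta> 1] \<beta> that by simp
      have gap: "gap \<beta> (2 - g) = (1 - \<beta> powr (2 - g)) / (2 - g)"
        "gap \<beta> (1 - g) = (1 - \<beta> powr (1 - g)) / (1 - g)"
        "gap \<beta> (2 - \<alpha> - g) = (1 - \<beta> powr (2 - \<alpha> - g)) / (2 - \<alpha> - g)"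
        using q_g g by (auto simp: gap_eq)
      have "share \<alpha> g \<beta> powr \<alpha> = gap \<beta> (2 - g) powr \<alpha> / gap \<beta> (1 - g) powr \<alpha> * (gap \<beta> (2 - \<alpha> - g) / gap \<beta> (2 - g))"
        using assms(2) gaps by (simp add: share_def powr_mult powr_divide powr_powr less_imp_le)
      then have "lams = ?N powr \<alpha> / c powr \<alpha> * (gap \<beta> (2 - g) powr \<alpha> / gap \<beta> (1 - g) powr \<alpha> * (gap \<beta> (2 - \<alpha> - g) / gap \<beta> (2 - g)))"
        using assms(1) user.share_pos[OF u, of \<alpha>] by (simp add: lams_eq S_hom powr_mult powr_divide less_imp_le)
      moreover have "gap \<beta> (2 - g) powr \<alpha> = (1 - \<beta> powr (2 - g)) powr \<alpha> / (2 - g) powr \<alpha>"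
        "gap \<beta> (1 - g) powr \<alpha> = (1 - \<beta> powr (1 - g)) powr \<alpha> / (1 - g) powr \<alpha>"
        using g powr_less[of "2 - g"] powr_less[of "1 - g"] by (auto simp: gap powr_divide)
      ultimately show "lams = ?N powr \<alpha> / c powr \<alpha> *
               ((1 - g) powr \<alpha> / (1 - \<beta> powr (1 - g)) powr \<alpha>) *
               ((1 - \<beta> powr (2 - g)) powr \<alpha> / (2 - g) powr \<alpha>) *
               ((2 - g) / (1 - \<beta> powr (2 - g))) *
               ((1 - \<beta> powr (2 - \<alpha> - g)) / (2 - \<alpha> - g))"
        by (simp add: gap(1,3) ac_simps)
      fix k
      \<comment> \<open>By symmetry each user consumes \<open>c / N\<close>; dividing by the
        consumption per unit of threshold gives the threshold without evaluating
        \<open>lams\<close>.\<close>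
      have "threshold \<alpha> (\<gamma> k) (b k) lams * (gap \<beta> (2 - g) / gap \<beta> (1 - g)) = share \<alpha> g \<beta> * (c / S)"
        using user.threshold_share[OF u q_g lams] hom powr_inv[OF S] by (simp add: lams_eq)
      also have "\<dots> = c / ?N"
        using user.share_pos[OF u, of \<alpha>] by (simp add: S_hom)
      finally have "threshold \<alpha> (\<gamma> k) (b k) lams = c / ?N * (gap \<beta> (1 - g) / gap \<beta> (2 - g))"
        using gaps[of "1 - g"] gaps[of "2 - g"] by (simp add: field_simps)
      then show "threshold \<alpha> (\<gamma> k) (b k) lams =
               c / ?N * ((1 - \<beta> powr (1 - g)) / (1 - g)) *
               ((2 - g) / (1 - \<beta> powr (2 - g)))"
        by (simp add: gap)
    next
      assume "g = 1"
      show "lams = 1 / c powr \<alpha> *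
               (?N *
                (((1 - \<beta> powr (1 - \<alpha>)) / ((1 - \<beta>) * (1 - \<alpha>))) powr (1 / \<alpha>) *
                 ((\<beta> - 1) / ln \<beta>))) powr \<alpha>"
        unfolding user.share_eq_1[OF u \<open>g = 1\<close> assms(2,3), symmetric]
        using S assms(1) by (simp add: lams_eq S_hom[symmetric] powr_divide)
    }
  qed
  show ?thesis
    unfolding Let_def lams_def[symmetric] \<Omega>_def[symmetric] T_def[symmetric]
    by (intro conjI \<Omega> convex_on finite slater T optimal homogeneous)
qed

end
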